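(* Let $(\mathfrak{g},[\cdot,\cdot],s,\alpha)$ be a finite-dimensional Hom-Lie superalgebra in characteristic $2$. Two one-parameter formal deformations $\mathfrak{g}_t$ and $\tilde{\mathfrak{g}}_t$ of $\mathfrak{g}$ given by the collections $(c,\mathfrak{p})=(c_i,\mathfrak{p}_i)_{i\ge0}$ and $(\tilde c,\tilde{\mathfrak{p}})=(\tilde c_i,\tilde{\mathfrak{p}}_i)_{i\ge0}$ are equivalent through an isomorphism of the form $\tau=\mathrm{id}_{\mathfrak{g}}+\sum_{i\ge1}t^i\tau_i$ if and only if $\tau$ links $(c,\mathfrak{p})$ and $(\tilde c,\tilde{\mathfrak{p}})$ by the following formulae, for all $n>0$: $$\sum_{i+j=n}\tau_i(\tilde c_j(x,y))=\sum_{i+j+k=n}c_i(\tau_j(x),\tau_k(y))\quad\text{for all }x,y\in\mathfrak{g},$$ and $$\sum_{i+j=n}\tau_i(\tilde{\mathfrak{p}}_j(x))=\sum_{i+j=n}c_i(x,\tau_j(x))+\sum_{2i+j=n}\mathfrak{p}_j(\tau_i(x))+\sum_{\substack{u+v+j=n\\ 1\le u<v,\ 1\le j}}c_j(\tau_u(x),\tau_v(x))\quad\text{for all }x\in\mathfrak{g}_{\bar 1}$$ (where $\tau_0=\mathrm{id}_{\mathfrak{g}}$ and indices are non-negative integers, subject to the further restrictions displayed). In particular, for $n=1$ we get $$\tilde c_1(x,y)=c_1(x,y)+\tau_1([x,y])+[x,\tau_1(y)]+[y,\tau_1(x)]\quad\text{for all }x,y\in\mathfrak{g},$$ $$\tilde{\mathfrak{p}}_1(x)=\mathfrak{p}_1(x)+\tau_1(s(x))+[x,\tau_1(x)]\quad\text{for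 all }x\in\mathfrak{g}_{\bar 1}.$$ Hence $(\tilde c_1,\tilde{\mathfrak{p}}_1)$ and $(c_1,\mathfrak{p}_1)$ are in the same cohomology class (in $\mathrm{H}^2_\alpha(\mathfrak{g};\mathfrak{g})$).
   Context: All vector spaces are over a field $\mathbb{K}$ of characteristic $2$. Hom-Lie superalgebra in characteristic 2: a quadruple $(\mathfrak{g},[\cdot,\cdot],s,\alpha)$ with $\mathfrak{g}=\mathfrak{g}_{\bar 0}\oplus\mathfrak{g}_{\bar 1}$ a superspace, $[\cdot,\cdot]$ a symmetric bilinear bracket, $s:\mathfrak{g}_{\bar 1}\to\mathfrak{g}_{\bar 0}$ with $s(\lambda x)=\lambda^2s(x)$, $\alpha\in\mathrm{End}(\mathfrak{g})$ even, such that (i) on $\mathfrak{g}_{\bar 0}$: $[x,x]=0$, $\alpha([x,y])=[\alpha(x),\alpha(y)]$ and $[\alpha(x),[y,z]]+[\alpha(y),[z,x]]+[\alpha(z),[x,y]]=0$; (ii) $\mathfrak{g}_{\bar 1}$ is a $\mathfrak{g}_{\bar 0}$-module via the bracket (made two-sided by symmetry): $[\alpha(x),\alpha(v)]=\alpha([x,v])$ and $[[x,y],\alpha(v)]=[\alpha(x),[y,v]]+[\alpha(y),[x,v]]$ for $x,y\in\mathfrak{g}_{\bar 0}$, $v\in\mathfrak{g}_{\bar 1}$; (iii) $(x,y)\mapsto s(x+y)+s(x)+s(y)$ on $\mathfrak{g}_{\bar 1}\times\mathfrak{g}_{\bar 1}$ is bilinear and equals $[x,y]$; (iv) $[s(x),\alpha(y)]=[\alpha(x),[x,y]]$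 for $x\in\mathfrak{g}_{\bar 1}$, $y\in\mathfrak{g}$; $\alpha([x,y])=[\alpha(x),\alpha(y)]$ for $x,y\in\mathfrak{g}$; $\alpha(s(x))=s(\alpha(x))$ for $x\in\mathfrak{g}_{\bar 1}$. An isomorphism of Hom-Lie superalgebras is a bijective even linear map preserving brackets and squarings and intertwining the twist maps. Cohomology with adjoint coefficients ($M=\mathfrak{g}$, $\beta=\alpha$): $XC^1_\alpha(\mathfrak{g};\mathfrak{g})$ is the space of linear maps $c:\mathfrak{g}\to\mathfrak{g}$ with $\alpha\circ c=c\circ\alpha$. $XC^2_\alpha(\mathfrak{g};\mathfrak{g})$ is the set of pairs $(c,\mathfrak{p})$ with $c:\wedge^2\mathfrak{g}\to\mathfrak{g}$ bilinear alternating, $\mathfrak{p}:\mathfrak{g}_{\bar 1}\to\mathfrak{g}$ with $\mathfrak{p}(\lambda x)=\lambda^2\mathfrak{p}(x)$, $\alpha(c(x,y))=c(\alpha(x),\alpha(y))$, $\alpha(\mathfrak{p}(x))=\mathfrak{p}(\alpha(x))$, and $\mathfrak{p}(x+y)+\mathfrak{p}(x)+\mathfrak{p}(y)=c(x,y)$ for $x,y\in\mathfrak{g}_{\bar 1}$; $XC^2_{\alpha,\bar 0}$ denotes even cochains ($c$ even, $\mathfrak{p}(\mathfrak{g}_{\bar 1})\subseteq\mathfrak{g}_{\bar 0}$). $\mathfrak{d}^1_\alpha(c)=(d^1_\alpha c,\mathfrak{q})$ with $d^1_\alpha c(x,z)=c([x,z])+[x,c(z)]+[z,c(x)]$, $\mathfrak{q}(x)=c(s(x))+[x,c(x)]$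 for $x\in\mathfrak{g}_{\bar 1}$. $\mathfrak{d}^2_\alpha(c,\mathfrak{p})=(d^2_\alpha c,d^2_\alpha\mathfrak{p})$ with $d^2_\alpha c(z_1,z_2,z_3)=[\alpha(z_1),c(z_2,z_3)]+c([z_1,z_2],\alpha(z_3))+$ cyclic permutations, and $d^2_\alpha\mathfrak{p}(x,z)=[\alpha(x),c(x,z)]+[\alpha(z),\mathfrak{p}(x)]+c(s(x),\alpha(z))+c([x,z],\alpha(x))$ for $x\in\mathfrak{g}_{\bar 1}$, $z\in\mathfrak{g}$. $\mathrm{H}^2_\alpha(\mathfrak{g};\mathfrak{g})=\ker\mathfrak{d}^2_\alpha/\mathrm{Im}\,\mathfrak{d}^1_\alpha$. Deformations: a (one-parameter formal) deformation $\mathfrak{g}_t$ of $\mathfrak{g}$ given by $(c_i,\mathfrak{p}_i)$ is a Hom-Lie superalgebra structure $([\cdot,\cdot]_t,s_t,\alpha)$ on $\mathfrak{g}\otimes\mathbb{K}[[t]]$ over $\mathbb{K}[[t]]$ ($\alpha$ extended $\mathbb{K}[[t]]$-linearly) with $\mathbb{K}[[t]]$-bilinear bracket $[x,y]_t=\sum_{i\ge0}c_i(x,y)t^i$ for $x,y\in\mathfrak{g}$ and squaring (with respect to $\mathbb{K}[[t]]$) $s_t(x)=\sum_{i\ge0}\mathfrak{p}_i(x)t^i$ for $x\in\mathfrak{g}_{\bar 1}$, where $c_0=[\cdot,\cdot]$, $\mathfrak{p}_0=s$, and $(c_i,\mathfrak{p}_i)\in XC^2_{\alpha,\bar 0}(\mathfrak{g};\mathfrak{g})$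 for $i\ge1$. Likewise $\tilde{\mathfrak{g}}_t=(\mathfrak{g}\otimes\mathbb{K}[[t]],\widetilde{[\cdot,\cdot]}_t,\tilde s_t,\alpha)$ is given by $(\tilde c_i,\tilde{\mathfrak{p}}_i)$ with $\tilde c_0=[\cdot,\cdot]$, $\tilde{\mathfrak{p}}_0=s$. Equivalence: $\mathfrak{g}_t$ and $\tilde{\mathfrak{g}}_t$ are equivalent if there exists a $\mathbb{K}[[t]]$-linear map $\tau:\mathfrak{g}_t\to\tilde{\mathfrak{g}}_t$ of the form $\tau(a)=a+\sum_{i\ge1}\tau_i(a)t^i$ for all $a\in\mathfrak{g}$ that is an isomorphism of Hom-Lie superalgebras; here the $\tau_i:\mathfrak{g}\to\mathfrak{g}$ are understood to be even linear maps commuting with $\alpha$.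
   Formalization: In the last sum of the squaring formula the restriction 1 ≤ j is dropped (j ≥ 0), as the printed formula fails at n=3; the linking τ is read as an isomorphism from g̃_t to g_t, as the formulae require, and equivalence in the stated direction is shown to hold iff some τ links. *)

theory Defs
  imports "HOL-Computational_Algebra.Computational_Algebra"
begin

section \<open>Hom-Lie superalgebras in characteristic 2\<close>

text \<open>
  A superspace is the type \<^typ>\<open>'v\<close> with a scalar multiplication \<open>sc\<close> and two submodules
  \<open>g0\<close> (even part) and \<open>g1\<close> (odd part). The scalars form a commutative ring, because the
  same notions are used over a field \<open>K\<close> and over \<open>K[[t]]\<close>. A squaring, or the second
  component of a cochain, is a total function of which only the values on \<open>g1\<close> matter.
\<close>

definition super_decomposition ::
  "('r::comm_ring_1 \<Rightarrow> 'v::ab_group_add \<Rightarrow> 'v) \<Rightarrow> 'v set \<Rightarrow> 'v set \<Rightarrow> bool" where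
  "super_decomposition sc g0 g1 \<longleftrightarrow>
     module.subspace sc g0 \<and> module.subspace sc g1 \<and> g0 \<inter> g1 = {0} \<and>
     (\<forall>x. \<exists>a\<in>g0. \<exists>b\<in>g1. x = a + b)"

definition bilinear_map ::
  "('r::comm_ring_1 \<Rightarrow> 'v::ab_group_add \<Rightarrow> 'v) \<Rightarrow> ('v \<Rightarrow> 'v \<Rightarrow> 'v) \<Rightarrow> bool" where
  "bilinear_map sc b \<longleftrightarrow>
     (\<forall>x. module_hom sc sc (b x)) \<and> (\<forall>y. module_hom sc sc (\<lambda>x. b x y))"

definition even_map :: "'v set \<Rightarrow> 'v set \<Rightarrow> ('v \<Rightarrow> 'v) \<Rightarrow> bool" where
  "even_map g0 g1 f \<longleftrightarrow> f ` g0 \<subseteq> g0 \<and> f ` g1 \<subseteq> g1"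

definition even_map2 :: "'v set \<Rightarrow> 'v set \<Rightarrow> ('v \<Rightarrow> 'v \<Rightarrow> 'v) \<Rightarrow> bool" where
  "even_map2 g0 g1 b \<longleftrightarrow>
     (\<forall>x\<in>g0. \<forall>y\<in>g0. b x y \<in> g0) \<and> (\<forall>x\<in>g0. \<forall>y\<in>g1. b x y \<in> g1) \<and>
     (\<forall>x\<in>g1. \<forall>y\<in>g0. b x y \<in> g1) \<and> (\<forall>x\<in>g1. \<forall>y\<in>g1. b x y \<in> g0)"

locale hom_lie_superalgebra = module sc
  for sc :: "'r::comm_ring_1 \<Rightarrow> 'v::ab_group_add \<Rightarrow> 'v" +
  fixes g0 g1 :: "'v set"
    and br :: "'v \<Rightarrow> 'v \<Rightarrow> 'v"
    and s :: "'v \<Rightarrow> 'v"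
    and \<alpha> :: "'v \<Rightarrow> 'v"
  assumes char_2: "CHAR('r) = 2"
    and decomposition: "super_decomposition sc g0 g1"
    and br_bilinear: "bilinear_map sc br"
    and br_even: "even_map2 g0 g1 br"
    and br_symmetric: "br x y = br y x"
    and s_even: "x \<in> g1 \<Longrightarrow> s x \<in> g0"
    and s_scale: "x \<in> g1 \<Longrightarrow> s (sc k x) = sc (k ^ 2) (s x)"
    and \<alpha>_linear: "module_hom sc sc \<alpha>"
    and \<alpha>_even: "even_map g0 g1 \<alpha>"
    and br_even_self: "x \<in> g0 \<Longrightarrow> br x x = 0"
    and \<alpha>_br_even: "\<lbrakk>x \<in> g0; y \<in> g0\<rbrakk> \<Longrightarrow> \<alpha> (br x y) = br (\<alpha> x) (\<alpha> y)"
    and hom_jacobi: "\<lbrakk>x \<in> g0; y \<in> g0; z \<in> g0\<rbrakk> \<Longrightarrow>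
      br (\<alpha> x) (br y z) + br (\<alpha> y) (br z x) + br (\<alpha> z) (br x y) = 0"
    and \<alpha>_action: "\<lbrakk>x \<in> g0; v \<in> g1\<rbrakk> \<Longrightarrow> br (\<alpha> x) (\<alpha> v) = \<alpha> (br x v)"
    and action: "\<lbrakk>x \<in> g0; y \<in> g0; v \<in> g1\<rbrakk> \<Longrightarrow>
      br (br x y) (\<alpha> v) = br (\<alpha> x) (br y v) + br (\<alpha> y) (br x v)"
    and s_polar: "\<lbrakk>x \<in> g1; y \<in> g1\<rbrakk> \<Longrightarrow> s (x + y) + s x + s y = br x y"
    and s_action: "x \<in> g1 \<Longrightarrow> br (s x) (\<alpha> y) = br (\<alpha> x) (br x y)"
    and \<alpha>_br: "\<alpha> (br x y) = br (\<alpha> x) (\<alpha> y)"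
    and \<alpha>_s: "x \<in> g1 \<Longrightarrow> \<alpha> (s x) = s (\<alpha> x)"

definition hom_lie_superalgebra_iso ::
  "('r::comm_ring_1 \<Rightarrow> 'v::ab_group_add \<Rightarrow> 'v) \<Rightarrow>
   'v set \<Rightarrow> 'v set \<Rightarrow> ('v \<Rightarrow> 'v \<Rightarrow> 'v) \<Rightarrow> ('v \<Rightarrow> 'v) \<Rightarrow> ('v \<Rightarrow> 'v) \<Rightarrow>
   ('r \<Rightarrow> 'w::ab_group_add \<Rightarrow> 'w) \<Rightarrow>
   'w set \<Rightarrow> 'w set \<Rightarrow> ('w \<Rightarrow> 'w \<Rightarrow> 'w) \<Rightarrow> ('w \<Rightarrow> 'w) \<Rightarrow> ('w \<Rightarrow> 'w) \<Rightarrow>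
   ('v \<Rightarrow> 'w) \<Rightarrow> bool" where
  "hom_lie_superalgebra_iso sc g0 g1 br s \<alpha> sc' h0 h1 br' s' \<alpha>' f \<longleftrightarrow>
     module_hom sc sc' f \<and> bij f \<and> f ` g0 \<subseteq> h0 \<and> f ` g1 \<subseteq> h1 \<and>
     (\<forall>x y. f (br x y) = br' (f x) (f y)) \<and>
     (\<forall>x\<in>g1. f (s x) = s' (f x)) \<and>
     (\<forall>x. f (\<alpha> x) = \<alpha>' (f x))"


section \<open>Cohomology with adjoint coefficients\<close>

definition XC1 ::
  "('k::field \<Rightarrow> 'v::ab_group_add \<Rightarrow> 'v) \<Rightarrow> ('v \<Rightarrow> 'v) \<Rightarrow> ('v \<Rightarrow> 'v) set" where
  "XC1 sc \<alpha> = {c. module_hom sc sc c \<and> (\<forall>x. \<alpha> (c x) = c (\<alpha> x))}"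

definition XC2 ::
  "('k::field \<Rightarrow> 'v::ab_group_add \<Rightarrow> 'v) \<Rightarrow> 'v set \<Rightarrow> ('v \<Rightarrow> 'v) \<Rightarrow>
   (('v \<Rightarrow> 'v \<Rightarrow> 'v) \<times> ('v \<Rightarrow> 'v)) set" where
  "XC2 sc g1 \<alpha> = {(c, p).
     bilinear_map sc c \<and> (\<forall>x. c x x = 0) \<and>
     (\<forall>k. \<forall>x\<in>g1. p (sc k x) = sc (k ^ 2) (p x)) \<and>
     (\<forall>x y. \<alpha> (c x y) = c (\<alpha> x) (\<alpha> y)) \<and>
     (\<forall>x\<in>g1. \<alpha> (p x) = p (\<alpha> x)) \<and>
     (\<forall>x\<in>g1. \<forall>y\<in>g1. p (x + y) + p x + p y = c x y)}"

definition XC2_even ::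
  "('k::field \<Rightarrow> 'v::ab_group_add \<Rightarrow> 'v) \<Rightarrow> 'v set \<Rightarrow> 'v set \<Rightarrow> ('v \<Rightarrow> 'v) \<Rightarrow>
   (('v \<Rightarrow> 'v \<Rightarrow> 'v) \<times> ('v \<Rightarrow> 'v)) set" where
  "XC2_even sc g0 g1 \<alpha> =
     {(c, p). (c, p) \<in> XC2 sc g1 \<alpha> \<and> even_map2 g0 g1 c \<and> p ` g1 \<subseteq> g0}"

definition d1 ::
  "('v::ab_group_add \<Rightarrow> 'v \<Rightarrow> 'v) \<Rightarrow> ('v \<Rightarrow> 'v) \<Rightarrow> ('v \<Rightarrow> 'v) \<Rightarrow>
   ('v \<Rightarrow> 'v \<Rightarrow> 'v) \<times> ('v \<Rightarrow> 'v)" where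
  "d1 br s c =
     (\<lambda>x z. c (br x z) + br x (c z) + br z (c x), \<lambda>x. c (s x) + br x (c x))"

definition d2c ::
  "('v::ab_group_add \<Rightarrow> 'v \<Rightarrow> 'v) \<Rightarrow> ('v \<Rightarrow> 'v) \<Rightarrow> ('v \<Rightarrow> 'v \<Rightarrow> 'v) \<Rightarrow> 'v \<Rightarrow> 'v \<Rightarrow> 'v \<Rightarrow> 'v" where
  "d2c br \<alpha> c z1 z2 z3 =
     br (\<alpha> z1) (c z2 z3) + c (br z1 z2) (\<alpha> z3) +
     br (\<alpha> z2) (c z3 z1) + c (br z2 z3) (\<alpha> z1) +
     br (\<alpha> z3) (c z1 z2) + c (br z3 z1) (\<alpha> z2)"

definition d2p ::
  "('v::ab_group_add \<Rightarrow> 'v \<Rightarrow> 'v) \<Rightarrow> ('v \<Rightarrow> 'v) \<Rightarrow> ('v \<Rightarrow> 'v) \<Rightarrow>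
   ('v \<Rightarrow> 'v \<Rightarrow> 'v) \<Rightarrow> ('v \<Rightarrow> 'v) \<Rightarrow> 'v \<Rightarrow> 'v \<Rightarrow> 'v" where
  "d2p br s \<alpha> c p x z =
     br (\<alpha> x) (c x z) + br (\<alpha> z) (p x) + c (s x) (\<alpha> z) + c (br x z) (\<alpha> x)"

definition Z2 ::
  "('k::field \<Rightarrow> 'v::ab_group_add \<Rightarrow> 'v) \<Rightarrow> 'v set \<Rightarrow> ('v \<Rightarrow> 'v \<Rightarrow> 'v) \<Rightarrow> ('v \<Rightarrow> 'v) \<Rightarrow> ('v \<Rightarrow> 'v) \<Rightarrow>
   (('v \<Rightarrow> 'v \<Rightarrow> 'v) \<times> ('v \<Rightarrow> 'v)) set" where
  "Z2 sc g1 br s \<alpha> = {(c, p). (c, p) \<in> XC2 sc g1 \<alpha> \<and>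
     (\<forall>z1 z2 z3. d2c br \<alpha> c z1 z2 z3 = 0) \<and> (\<forall>x\<in>g1. \<forall>z. d2p br s \<alpha> c p x z = 0)}"

text \<open>Second components are compared on \<open>g1\<close> only, so the values of total functions outside
  \<open>g1\<close> do not affect the quotient \<open>H2\<close>.\<close>

definition B2 ::
  "('k::field \<Rightarrow> 'v::ab_group_add \<Rightarrow> 'v) \<Rightarrow> 'v set \<Rightarrow> ('v \<Rightarrow> 'v \<Rightarrow> 'v) \<Rightarrow> ('v \<Rightarrow> 'v) \<Rightarrow> ('v \<Rightarrow> 'v) \<Rightarrow>
   (('v \<Rightarrow> 'v \<Rightarrow> 'v) \<times> ('v \<Rightarrow> 'v)) set" where
  "B2 sc g1 br s \<alpha> = {(c, p). \<exists>a\<in>XC1 sc \<alpha>.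
     (\<forall>x y. c x y = fst (d1 br s a) x y) \<and> (\<forall>x\<in>g1. p x = snd (d1 br s a) x)}"

definition cohomologous ::
  "('k::field \<Rightarrow> 'v::ab_group_add \<Rightarrow> 'v) \<Rightarrow> 'v set \<Rightarrow> ('v \<Rightarrow> 'v \<Rightarrow> 'v) \<Rightarrow> ('v \<Rightarrow> 'v) \<Rightarrow> ('v \<Rightarrow> 'v) \<Rightarrow>
   ((('v \<Rightarrow> 'v \<Rightarrow> 'v) \<times> ('v \<Rightarrow> 'v)) \<times> (('v \<Rightarrow> 'v \<Rightarrow> 'v) \<times> ('v \<Rightarrow> 'v))) set" where
  "cohomologous sc g1 br s \<alpha> = {((c, p), (c', p')).
     (c, p) \<in> Z2 sc g1 br s \<alpha> \<and> (c', p') \<in> Z2 sc g1 br s \<alpha> \<and>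
     (\<lambda>x y. c x y - c' x y, \<lambda>x. p x - p' x) \<in> B2 sc g1 br s \<alpha>}"

definition H2 ::
  "('k::field \<Rightarrow> 'v::ab_group_add \<Rightarrow> 'v) \<Rightarrow> 'v set \<Rightarrow> ('v \<Rightarrow> 'v \<Rightarrow> 'v) \<Rightarrow> ('v \<Rightarrow> 'v) \<Rightarrow> ('v \<Rightarrow> 'v) \<Rightarrow>
   (('v \<Rightarrow> 'v \<Rightarrow> 'v) \<times> ('v \<Rightarrow> 'v)) set set" where
  "H2 sc g1 br s \<alpha> = Z2 sc g1 br s \<alpha> // cohomologous sc g1 br s \<alpha>"


section \<open>Extension of scalars to formal power series\<close>

text \<open>
  For finite-dimensional \<open>g\<close> the \<open>K[[t]]\<close>-module \<open>g \<otimes> K[[t]]\<close> is \<open>g[[t]]\<close>, here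
  \<^typ>\<open>'v fps\<close> with the Cauchy product as scalar multiplication; \<open>a \<otimes> 1\<close> is
  \<^term>\<open>fps_const a\<close>. The lemma \<open>ext_scale_basis\<close> below shows that a basis of \<open>g\<close> is a
  \<open>K[[t]]\<close>-basis of \<open>g[[t]]\<close>.
\<close>

definition ext_scale ::
  "('k::comm_ring_1 \<Rightarrow> 'v::ab_group_add \<Rightarrow> 'v) \<Rightarrow> 'k fps \<Rightarrow> 'v fps \<Rightarrow> 'v fps" where
  "ext_scale sc f x = Abs_fps (\<lambda>n. \<Sum>i\<le>n. sc (fps_nth f i) (fps_nth x (n - i)))"

definition ext_sub :: "'v::zero set \<Rightarrow> 'v fps set" where
  "ext_sub A = {x. \<forall>n. fps_nth x n \<in> A}"

definition ext_map :: "('v::zero \<Rightarrow> 'v) \<Rightarrow> 'v fps \<Rightarrow> 'v fps" where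
  "ext_map f x = Abs_fps (\<lambda>n. f (fps_nth x n))"

lemma module_ext_scale:
  fixes sc :: "'k::comm_ring_1 \<Rightarrow> 'v::ab_group_add \<Rightarrow> 'v"
  assumes "module sc"
  shows "module (ext_scale sc)"
proof -
  interpret module sc by fact
  show ?thesis
  proof
    fix a b :: "'k fps" and x y :: "'v fps"
    show "ext_scale sc a (x + y) = ext_scale sc a x + ext_scale sc a y"
      by (rule fps_ext) (simp add: ext_scale_def scale_right_distrib sum.distrib)
    show "ext_scale sc (a + b) x = ext_scale sc a x + ext_scale sc b x"
      by (rule fps_ext) (simp add: ext_scale_def scale_left_distrib sum.distrib)
    show "ext_scale sc 1 x = x"
    proof (rule fps_ext)
      fix n
      have "(\<Sum>i\<le>n. sc (fps_nth 1 i) (fps_nth x (n - i))) =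
            (\<Sum>i\<le>n. if i = 0 then fps_nth x n else 0)"
        by (rule sum.cong) auto
      then show "fps_nth (ext_scale sc 1 x) n = fps_nth x n"
        by (simp add: ext_scale_def)
    qed
    show "ext_scale sc a (ext_scale sc b x) = ext_scale sc (a * b) x"
    proof (rule fps_ext)
      fix n
      have "fps_nth (ext_scale sc a (ext_scale sc b x)) n =
          (\<Sum>i\<le>n. \<Sum>j\<le>n - i. sc (fps_nth a i * fps_nth b j) (fps_nth x (n - i - j)))"
        by (simp add: ext_scale_def scale_sum_right)
      also have "\<dots> = (\<Sum>(i,j)\<in>(SIGMA i:{..n}. {..n - i}).
          sc (fps_nth a i * fps_nth b j) (fps_nth x (n - i - j)))"
        by (subst sum.Sigma) auto
      also have "\<dots> = (\<Sum>(k,i)\<in>(SIGMA k:{..n}. {0..k}).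
          sc (fps_nth a i * fps_nth b (k - i)) (fps_nth x (n - k)))"
        by (rule sum.reindex_bij_witness
            [where i = "\<lambda>(k,i). (i, k - i)" and j = "\<lambda>(i,j). (i + j, i)"]) auto
      also have "\<dots> = (\<Sum>k\<le>n. \<Sum>i=0..k.
          sc (fps_nth a i * fps_nth b (k - i)) (fps_nth x (n - k)))"
        by (subst sum.Sigma) auto
      also have "\<dots> = fps_nth (ext_scale sc (a * b) x) n"
        by (simp add: ext_scale_def fps_mult_nth scale_sum_left)
      finally show "fps_nth (ext_scale sc a (ext_scale sc b x)) n =
          fps_nth (ext_scale sc (a * b) x) n" .
    qed
  qed
qed

lemma ext_scale_fps_const_nth:
  fixes sc :: "'k::comm_ring_1 \<Rightarrow> 'v::ab_group_add \<Rightarrow> 'v"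
  assumes "module sc"
  shows "fps_nth (ext_scale sc f (fps_const b)) n = sc (fps_nth f n) b"
proof -
  interpret module sc by fact
  have "(\<Sum>i\<le>n. sc (fps_nth f i) (fps_nth (fps_const b) (n - i))) =
        (\<Sum>i\<le>n. if i = n then sc (fps_nth f n) b else 0)"
    by (rule sum.cong) auto
  then show ?thesis by (simp add: ext_scale_def)
qed

lemma ext_scale_basis:
  fixes sc :: "'k::field \<Rightarrow> 'v::ab_group_add \<Rightarrow> 'v"
  assumes "finite_dimensional_vector_space sc B"
  shows "\<exists>!f. (\<forall>b. b \<notin> B \<longrightarrow> f b = 0) \<and> x = (\<Sum>b\<in>B. ext_scale sc (f b) (fps_const b))"
proof -
  interpret finite_dimensional_vector_space sc B by fact
  have fin: "finite B" by (rule finite_Basis)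
  have nth: "fps_nth (\<Sum>b\<in>B. ext_scale sc (f b) (fps_const b)) n =
      (\<Sum>b\<in>B. sc (fps_nth (f b) n) b)" for f n
    by (simp add: fps_sum_nth ext_scale_fps_const_nth[OF module_axioms])
  show ?thesis
  proof (rule ex1I)
    let ?f = "\<lambda>b. Abs_fps (\<lambda>n. representation B (fps_nth x n) b)"
    have "?f b = 0" if "b \<notin> B" for b
      using that representation_ne_zero[of B] by (intro fps_ext) auto
    moreover have "x = (\<Sum>b\<in>B. ext_scale sc (?f b) (fps_const b))"
      by (rule fps_ext) (simp add: nth sum_representation_eq independent_Basis fin span_Basis)
    ultimately show "(\<forall>b. b \<notin> B \<longrightarrow> ?f b = 0) \<and>
        x = (\<Sum>b\<in>B. ext_scale sc (?f b) (fps_const b))" by blast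
  next
    fix f assume f: "(\<forall>b. b \<notin> B \<longrightarrow> f b = 0) \<and>
        x = (\<Sum>b\<in>B. ext_scale sc (f b) (fps_const b))"
    show "f = (\<lambda>b. Abs_fps (\<lambda>n. representation B (fps_nth x n) b))"
    proof (intro ext fps_ext)
      fix b n
      have x: "fps_nth x n = (\<Sum>b\<in>B. sc (fps_nth (f b) n) b)"
        using f nth by simp
      have "representation B (\<Sum>b\<in>B. sc (fps_nth (f b) n) b) = (\<lambda>b. fps_nth (f b) n)"
        using f fin independent_Basis
        by (intro representation_eqI) (auto intro!: span_Basis finite_subset[OF _ fin]
            sum.mono_neutral_left simp: span_Basis intro: ccontr)
      then show "fps_nth (f b) n =
          fps_nth (Abs_fps (\<lambda>n. representation B (fps_nth x n) b)) n"
        by (simp add: x)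
    qed
  qed
qed


section \<open>Formal deformations and their equivalence\<close>

definition deformation ::
  "('k::field \<Rightarrow> 'v::ab_group_add \<Rightarrow> 'v) \<Rightarrow> 'v set \<Rightarrow> 'v set \<Rightarrow> ('v \<Rightarrow> 'v \<Rightarrow> 'v) \<Rightarrow> ('v \<Rightarrow> 'v) \<Rightarrow> ('v \<Rightarrow> 'v) \<Rightarrow>
   (nat \<Rightarrow> 'v \<Rightarrow> 'v \<Rightarrow> 'v) \<Rightarrow> (nat \<Rightarrow> 'v \<Rightarrow> 'v) \<Rightarrow>
   ('v fps \<Rightarrow> 'v fps \<Rightarrow> 'v fps) \<Rightarrow> ('v fps \<Rightarrow> 'v fps) \<Rightarrow> bool" where
  "deformation sc g0 g1 br s \<alpha> c p brt st \<longleftrightarrow>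
     hom_lie_superalgebra (ext_scale sc) (ext_sub g0) (ext_sub g1) brt st (ext_map \<alpha>) \<and>
     (\<forall>x y. brt (fps_const x) (fps_const y) = Abs_fps (\<lambda>i. c i x y)) \<and>
     (\<forall>x\<in>g1. st (fps_const x) = Abs_fps (\<lambda>i. p i x)) \<and>
     (\<forall>x y. c 0 x y = br x y) \<and> (\<forall>x\<in>g1. p 0 x = s x) \<and>
     (\<forall>i\<ge>1. (c i, p i) \<in> XC2_even sc g0 g1 \<alpha>)"

definition coefficient_maps ::
  "('k::field \<Rightarrow> 'v::ab_group_add \<Rightarrow> 'v) \<Rightarrow> 'v set \<Rightarrow> 'v set \<Rightarrow> ('v \<Rightarrow> 'v) \<Rightarrow> (nat \<Rightarrow> 'v \<Rightarrow> 'v) \<Rightarrow> bool" where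
  "coefficient_maps sc g0 g1 \<alpha> \<tau> \<longleftrightarrow>
     \<tau> 0 = id \<and>
     (\<forall>i\<ge>1. module_hom sc sc (\<tau> i) \<and> even_map g0 g1 (\<tau> i) \<and> (\<forall>x. \<tau> i (\<alpha> x) = \<alpha> (\<tau> i x)))"

text \<open>\<open>iso_through sc g0 g1 \<alpha> brt st brt' st' \<tau>\<close>: the \<open>K[[t]]\<close>-linear map
  \<open>\<Sum>i. t^i \<tau> i\<close> is an isomorphism from the deformation with structure \<open>(brt, st)\<close> to the
  one with structure \<open>(brt', st')\<close>.\<close>

definition iso_through ::
  "('k::field \<Rightarrow> 'v::ab_group_add \<Rightarrow> 'v) \<Rightarrow> 'v set \<Rightarrow> 'v set \<Rightarrow> ('v \<Rightarrow> 'v) \<Rightarrow>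
   ('v fps \<Rightarrow> 'v fps \<Rightarrow> 'v fps) \<Rightarrow> ('v fps \<Rightarrow> 'v fps) \<Rightarrow>
   ('v fps \<Rightarrow> 'v fps \<Rightarrow> 'v fps) \<Rightarrow> ('v fps \<Rightarrow> 'v fps) \<Rightarrow> (nat \<Rightarrow> 'v \<Rightarrow> 'v) \<Rightarrow> bool" where
  "iso_through sc g0 g1 \<alpha> brt st brt' st' \<tau> \<longleftrightarrow>
     (\<exists>T. (\<forall>a. T (fps_const a) = Abs_fps (\<lambda>i. \<tau> i a)) \<and>
        hom_lie_superalgebra_iso
          (ext_scale sc) (ext_sub g0) (ext_sub g1) brt st (ext_map \<alpha>)
          (ext_scale sc) (ext_sub g0) (ext_sub g1) brt' st' (ext_map \<alpha>) T)"

definition equivalent_deformations ::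
  "('k::field \<Rightarrow> 'v::ab_group_add \<Rightarrow> 'v) \<Rightarrow> 'v set \<Rightarrow> 'v set \<Rightarrow> ('v \<Rightarrow> 'v) \<Rightarrow>
   ('v fps \<Rightarrow> 'v fps \<Rightarrow> 'v fps) \<Rightarrow> ('v fps \<Rightarrow> 'v fps) \<Rightarrow>
   ('v fps \<Rightarrow> 'v fps \<Rightarrow> 'v fps) \<Rightarrow> ('v fps \<Rightarrow> 'v fps) \<Rightarrow> bool" where
  "equivalent_deformations sc g0 g1 \<alpha> brt st brt' st' \<longleftrightarrow>
     (\<exists>\<tau>. coefficient_maps sc g0 g1 \<alpha> \<tau> \<and> iso_through sc g0 g1 \<alpha> brt st brt' st' \<tau>)"

text \<open>
  The formulae for \<open>\<tau>\<close> as a map from the deformation \<open>(c', p')\<close> to \<open>(c, p)\<close>. The last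
  sum of the second formula collects the mixed terms of the squaring of \<open>\<Sum>i. t^i \<tau> i x\<close>.
  Its index \<open>j\<close> starts at \<open>0\<close>: the terms \<open>[\<tau> u x, \<tau> v x]\<close> with \<open>u + v = n\<close> belong to it.
  Without them the formula fails. Let \<open>g0 = K z\<close>, \<open>g1 = K x + K y + K w\<close>, \<open>\<alpha> = id\<close>, with
  \<open>[y, w] = z\<close> the only nonzero bracket of basis vectors, \<open>s (a x + b y + d w) = b d z\<close>,
  \<open>(c i, p i) = 0\<close> for \<open>i > 0\<close>, \<open>\<tau> 1\<close> and \<open>\<tau> 2\<close> the maps sending \<open>x\<close> to \<open>y\<close> and to \<open>w\<close>
  and the other basis vectors to \<open>0\<close>, \<open>\<tau> i = 0\<close> for \<open>i > 2\<close>, and \<open>(c', p')\<close> the structure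
  transported along \<open>\<tau>\<close>. Then \<open>p' 3 x = z\<close>, and for \<open>n = 3\<close> the only nonzero term on the
  right is \<open>[\<tau> 1 x, \<tau> 2 x] = z\<close>.
\<close>

definition linked ::
  "'v::ab_group_add set \<Rightarrow> (nat \<Rightarrow> 'v \<Rightarrow> 'v \<Rightarrow> 'v) \<Rightarrow> (nat \<Rightarrow> 'v \<Rightarrow> 'v) \<Rightarrow>
   (nat \<Rightarrow> 'v \<Rightarrow> 'v \<Rightarrow> 'v) \<Rightarrow> (nat \<Rightarrow> 'v \<Rightarrow> 'v) \<Rightarrow> (nat \<Rightarrow> 'v \<Rightarrow> 'v) \<Rightarrow> bool" where
  "linked g1 c p c' p' \<tau> \<longleftrightarrow>
     (\<forall>n>0.
       (\<forall>x y. (\<Sum>(i,j) | i + j = n. \<tau> i (c' j x y)) =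
              (\<Sum>(i,j,k) | i + j + k = n. c i (\<tau> j x) (\<tau> k y))) \<and>
       (\<forall>x\<in>g1. (\<Sum>(i,j) | i + j = n. \<tau> i (p' j x)) =
              (\<Sum>(i,j) | i + j = n. c i x (\<tau> j x)) +
              (\<Sum>(i,j) | 2 * i + j = n. p j (\<tau> i x)) +
              (\<Sum>(u,v,j) | u + v + j = n \<and> 1 \<le> u \<and> u < v. c j (\<tau> u x) (\<tau> v x))))"

end

theory Submission
  imports Defs
begin

text \<open>
  Write \<open>T = \<Sum>i. t^i \<tau> i\<close>. The formulae in \<^const>\<open>linked\<close> are the coefficients of \<open>t^n\<close> in
  \<open>T [x, y]' = [T x, T y]\<close> and \<open>T (s' x) = s (T x)\<close> for constant series \<open>x\<close> and \<open>y\<close>, primes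
  marking the source deformation; at \<open>n = 0\<close> both identities hold because \<open>\<tau> 0 = id\<close> and both
  deformations start from the same superalgebra. The first formula is bilinearity. For the second,
  the squaring of a sum is the sum of the squarings plus the brackets of the pairs, so
  \<open>s (\<Sum>i. t^i y_i) = \<Sum>i. t^(2i) s(y_i) + \<Sum>u<v. t^(u+v) [y_u, y_v]\<close> (\<open>st_nth\<close>). The pairs with
  \<open>u = 0\<close> form the first sum on the right of the formula; its term for \<open>j = 0\<close> is
  \<open>c n x x = 0\<close> (\<open>linked_iff_on_constants\<close>).

  It remains to pass from constant series to all of them and to see that \<open>T\<close> is bijective.
  A \<open>K[[t]]\<close>-linear map commutes with multiplication by \<open>t\<close>, so writing
  \<open>x = x_0 + t x'\<close> and inducting on the degree shows that every coefficient of \<open>F x\<close> is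
  determined by the values of \<open>F\<close> on constants: linear maps are automatically continuous for the
  \<open>t\<close>-adic topology, and no infinite sum has to be exchanged with a map that is only known to be
  additive (\<open>ext_linear_nth\<close>). The same splitting settles the bracket and, by polarization, the
  squaring. Since \<open>\<tau> 0\<close> is the identity, \<open>T x = y\<close> is solved degree by degree
  (\<open>series_map_bij\<close>). This gives \<open>iso_through_iff_linked\<close>.

  Equivalence of deformations is stated with a map in one direction and \<^const>\<open>linked\<close> with a map
  in the other; the inverse of an isomorphism of the form \<open>id + O(t)\<close> has the same form
  (\<open>iso_through_inverse\<close>).

  Finally, the coefficients of degree 1 of the Hom-Jacobi identity and of
  \<open>[s(x), \<alpha>(y)] = [\<alpha>(x), [x, y]]\<close> in a deformation say that \<open>(c 1, p 1)\<close> is a cocycle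
  (\<open>infinitesimal_cocycle\<close>). This uses the Hom-Jacobi identity for arguments of arbitrary parity,
  which follows from the axioms by polarizing the squaring (\<open>jacobi\<close>). The formulae for \<open>n = 1\<close>
  then say that the two cocycles differ by the coboundary of \<open>\<tau> 1\<close>.
\<close>

section \<open>Sums over decompositions of a degree\<close>

lemma sum_pairs_with_total:
  fixes f :: "nat \<Rightarrow> nat \<Rightarrow> 'a::comm_monoid_add"
  shows "(\<Sum>(i,j) | i + j = n. f i j) = (\<Sum>j\<le>n. f (n - j) j)"
  by (rule sum.reindex_bij_witness[where i = "\<lambda>j. (n - j, j)" and j = snd]) auto

lemma sum_triples_with_total:
  fixes f :: "nat \<Rightarrow> nat \<Rightarrow> nat \<Rightarrow> 'a::comm_monoid_add"
  shows "(\<Sum>(i,j,k) | i + j + k = n. f i j k) = (\<Sum>j\<le>n. \<Sum>k\<le>n - j. f (n - j - k) j k)"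
proof -
  have "(\<Sum>j\<le>n. \<Sum>k\<le>n - j. f (n - j - k) j k) =
      (\<Sum>(j,k)\<in>(SIGMA j:{..n}. {..n - j}). f (n - j - k) j k)"
    by (rule sum.Sigma) auto
  also have "\<dots> = (\<Sum>(i,j,k) | i + j + k = n. f i j k)"
    by (rule sum.reindex_bij_witness
        [where i = "\<lambda>(i,j,k). (j, k)" and j = "\<lambda>(j,k). (n - j - k, j, k)"]) auto
  finally show ?thesis by simp
qed

lemma finite_doubled_pairs: "finite {(i,j). 2 * i + j = (n::nat)}"
  by (rule finite_subset[of _ "{..n} \<times> {..n}"]) auto

lemma finite_ordered_triples: "finite {(u,v,j). u + v + j = (n::nat) \<and> P u v}"
  by (rule finite_subset[of _ "{..n} \<times> {..n} \<times> {..n}"]) auto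

text \<open>
  This recursion and \<open>sum_ordered_triples_rec\<close> mirror, coefficient by coefficient, the splitting of
  the squaring of \<open>x_0 + t y\<close> into \<open>s(x_0) + t^2 s(y) + t [x_0, y]\<close>: the squares and the brackets
  within \<open>t y\<close> have all their indices shifted by one, which lowers the total degree by two.
\<close>

lemma sum_doubled_pairs_rec:
  fixes f :: "nat \<Rightarrow> nat \<Rightarrow> 'a::comm_monoid_add"
  shows "(\<Sum>(i,j) | 2 * i + j = n. f i j) =
    f 0 n + (if n < 2 then 0 else \<Sum>(i,j) | 2 * i + j = n - 2. f (Suc i) j)"
proof -
  have split: "{(i,j). 2 * i + j = n} = insert (0, n) {(i,j). 2 * i + j = n \<and> 0 < i}"
    by auto
  have fin: "finite {(i,j). 2 * i + j = n \<and> 0 < i}"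
    by (rule finite_subset[OF _ finite_doubled_pairs[of n]]) auto
  have "(\<Sum>(i,j) | 2 * i + j = n \<and> 0 < i. f i j) =
      (if n < 2 then 0 else \<Sum>(i,j) | 2 * i + j = n - 2. f (Suc i) j)"
  proof (cases "n < 2")
    case True
    then have "{(i,j). 2 * i + j = n \<and> 0 < i} = {}" by auto
    with True show ?thesis by (simp only: sum.empty if_True)
  next
    case False
    have "(\<Sum>(i,j) | 2 * i + j = n \<and> 0 < i. f i j) = (\<Sum>(i,j) | 2 * i + j = n - 2. f (Suc i) j)"
      using False by (intro sum.reindex_bij_witness
        [where i = "\<lambda>(i,j). (Suc i, j)" and j = "\<lambda>(i,j). (i - 1, j)"]) auto
    with False show ?thesis by simp
  qed
  with fin show ?thesis unfolding split by (subst sum.insert) auto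
qed

lemma sum_ordered_triples_first_zero:
  fixes f :: "nat \<Rightarrow> nat \<Rightarrow> nat \<Rightarrow> 'a::comm_monoid_add"
  shows "(\<Sum>(u,v,j) | u + v + j = n \<and> u < v. f u v j) =
    (\<Sum>v\<in>{1..n}. f 0 v (n - v)) + (\<Sum>(u,v,j) | u + v + j = n \<and> 1 \<le> u \<and> u < v. f u v j)"
proof -
  have split: "{(u,v,j). u + v + j = n \<and> u < v} =
      {(u,v,j). u + v + j = n \<and> u = 0 \<and> u < v} \<union> {(u,v,j). u + v + j = n \<and> 1 \<le> u \<and> u < v}"
    by auto
  have "(\<Sum>(u,v,j) | u + v + j = n \<and> u = 0 \<and> u < v. f u v j) = (\<Sum>v\<in>{1..n}. f 0 v (n - v))"
    by (rule sum.reindex_bij_witness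
        [where i = "\<lambda>v. (0, v, n - v)" and j = "\<lambda>(u,v,j). v"]) auto
  then show ?thesis
    unfolding split by (subst sum.union_disjoint) (auto simp: finite_ordered_triples)
qed

lemma sum_ordered_triples_rec:
  fixes f :: "nat \<Rightarrow> nat \<Rightarrow> nat \<Rightarrow> 'a::comm_monoid_add"
  shows "(\<Sum>(u,v,j) | u + v + j = n \<and> u < v. f u v j) =
    (\<Sum>v\<in>{1..n}. f 0 v (n - v)) +
    (if n < 2 then 0 else \<Sum>(u,v,j) | u + v + j = n - 2 \<and> u < v. f (Suc u) (Suc v) j)"
proof -
  have "(\<Sum>(u,v,j) | u + v + j = n \<and> 1 \<le> u \<and> u < v. f u v j) =
      (if n < 2 then 0 else \<Sum>(u,v,j) | u + v + j = n - 2 \<and> u < v. f (Suc u) (Suc v) j)"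
  proof (cases "n < 2")
    case True
    then have "{(u,v,j). u + v + j = n \<and> 1 \<le> u \<and> u < v} = {}" by auto
    with True show ?thesis by (simp only: sum.empty if_True)
  next
    case False
    have "(\<Sum>(u,v,j) | u + v + j = n \<and> 1 \<le> u \<and> u < v. f u v j) =
        (\<Sum>(u,v,j) | u + v + j = n - 2 \<and> u < v. f (Suc u) (Suc v) j)"
      using False by (intro sum.reindex_bij_witness
        [where i = "\<lambda>(u,v,j). (Suc u, Suc v, j)" and j = "\<lambda>(u,v,j). (u - 1, v - 1, j)"]) auto
    with False show ?thesis by simp
  qed
  then show ?thesis by (simp only: sum_ordered_triples_first_zero)
qed


section \<open>Linear maps between modules of power series\<close>

lemma ext_map_fps_const: "f 0 = 0 \<Longrightarrow> ext_map f (fps_const a) = fps_const (f a)"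
  by (rule fps_ext) (simp add: ext_map_def)

lemma fps_const_in_ext_sub: "0 \<in> A \<Longrightarrow> a \<in> A \<Longrightarrow> fps_const a \<in> ext_sub A"
  by (simp add: ext_sub_def)

lemma fps_shift_in_ext_sub: "x \<in> ext_sub A \<Longrightarrow> fps_shift k x \<in> ext_sub A"
  by (simp add: ext_sub_def)

definition series_map :: "(nat \<Rightarrow> 'v \<Rightarrow> 'v) \<Rightarrow> 'v::ab_group_add fps \<Rightarrow> 'v fps" where
  "series_map \<tau> x = Abs_fps (\<lambda>n. \<Sum>j\<le>n. \<tau> (n - j) (fps_nth x j))"

lemma series_map_nth: "fps_nth (series_map \<tau> x) n = (\<Sum>j\<le>n. \<tau> (n - j) (fps_nth x j))"
  by (simp add: series_map_def)

lemma series_map_fps_const: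
  assumes "\<And>i. \<tau> i 0 = 0"
  shows "series_map \<tau> (fps_const a) = Abs_fps (\<lambda>i. \<tau> i a)"
proof (rule fps_ext)
  fix n
  have "(\<Sum>j\<le>n. \<tau> (n - j) (fps_nth (fps_const a) j)) = (\<Sum>j\<le>n. if j = 0 then \<tau> n a else 0)"
    using assms by (intro sum.cong) auto
  then show "fps_nth (series_map \<tau> (fps_const a)) n = fps_nth (Abs_fps (\<lambda>i. \<tau> i a)) n"
    by (simp add: series_map_nth)
qed

text \<open>
  For \<open>\<tau> 0 = id\<close> the coefficient of degree \<open>n\<close> of \<open>\<Sum>i. t^i \<tau> i\<close> at \<open>x\<close> is \<open>x_n\<close> plus terms in
  lower coefficients of \<open>x\<close>, so a preimage of \<open>y\<close> can be computed by recursion on the degree.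
\<close>

fun series_map_preimage_coeff ::
  "(nat \<Rightarrow> 'v \<Rightarrow> 'v) \<Rightarrow> 'v::ab_group_add fps \<Rightarrow> nat \<Rightarrow> 'v" where
  "series_map_preimage_coeff \<tau> y n =
     fps_nth y n - (\<Sum>j<n. \<tau> (n - j) (series_map_preimage_coeff \<tau> y j))"

declare series_map_preimage_coeff.simps [simp del]

lemma series_map_bij:
  assumes "\<tau> 0 = id"
  shows "bij (series_map \<tau>)"
proof -
  have nth: "fps_nth (series_map \<tau> x) n = fps_nth x n + (\<Sum>j<n. \<tau> (n - j) (fps_nth x j))" for x n
    using assms by (simp add: series_map_nth lessThan_Suc_atMost[symmetric] add.commute)
  have "inj (series_map \<tau>)"
  proof (rule injI, rule fps_ext)
    fix x y n assume eq: "series_map \<tau> x = series_map \<tau> y"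
    show "fps_nth x n = fps_nth y n"
    proof (induction n rule: less_induct)
      case (less n)
      then have "(\<Sum>j<n. \<tau> (n - j) (fps_nth x j)) = (\<Sum>j<n. \<tau> (n - j) (fps_nth y j))"
        by (intro sum.cong) auto
      with nth[of x n] nth[of y n] eq show ?case by simp
    qed
  qed
  moreover have "series_map \<tau> (Abs_fps (series_map_preimage_coeff \<tau> y)) = y" for y
  proof (rule fps_ext)
    fix n
    show "fps_nth (series_map \<tau> (Abs_fps (series_map_preimage_coeff \<tau> y))) n = fps_nth y n"
      unfolding nth fps_nth_Abs_fps by (subst series_map_preimage_coeff.simps) simp
  qed
  then have "surj (series_map \<tau>)" by (rule surjI)
  ultimately show ?thesis by (simp add: bij_def)
qed

context module
begin

lemma fps_const_scale: "fps_const (scale k a) = ext_scale scale (fps_const k) (fps_const a)"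
  by (rule fps_ext) (simp add: ext_scale_fps_const_nth[OF module_axioms])

lemma ext_scale_X_nth:
  "fps_nth (ext_scale scale fps_X x) n = (if n = 0 then 0 else fps_nth x (n - 1))"
proof -
  have "(\<Sum>i\<le>n. scale (fps_nth fps_X i) (fps_nth x (n - i))) =
      (\<Sum>i\<le>n. if i = 1 then fps_nth x (n - 1) else 0)"
    by (rule sum.cong) auto
  then show ?thesis by (simp add: ext_scale_def)
qed

lemma ext_scale_X2_nth:
  "fps_nth (ext_scale scale (fps_X ^ 2) x) n = (if n < 2 then 0 else fps_nth x (n - 2))"
proof -
  interpret ext: module "ext_scale scale" by (rule module_ext_scale) (rule module_axioms)
  have "ext_scale scale (fps_X ^ 2) x = ext_scale scale fps_X (ext_scale scale fps_X x)"
    by (simp add: power2_eq_square)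
  then show ?thesis by (auto simp: ext_scale_X_nth numeral_2_eq_2 simp del: ext.scale_scale)
qed

lemma fps_head_tail: "x = fps_const (fps_nth x 0) + ext_scale scale fps_X (fps_shift 1 x)"
  by (rule fps_ext) (simp add: ext_scale_X_nth)

lemma ext_scale_in_ext_sub:
  assumes "subspace A" "x \<in> ext_sub A"
  shows "ext_scale scale f x \<in> ext_sub A"
  using assms by (auto simp: ext_sub_def ext_scale_def intro!: subspace_sum subspace_scale)

text \<open>
  The automatic \<open>t\<close>-adic continuity of linear maps. The right-hand side is a finite sum because the
  part of \<open>x\<close> divisible by \<open>t^(n+1)\<close> is sent to a multiple of \<open>t^(n+1)\<close>.
\<close>

lemma ext_linear_nth:
  assumes "module_hom (ext_scale scale) (ext_scale scale) F"
  shows "fps_nth (F x) n = (\<Sum>j\<le>n. fps_nth (F (fps_const (fps_nth x j))) (n - j))"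
proof (induction n arbitrary: x)
  interpret F: module_hom "ext_scale scale" "ext_scale scale" F by fact
  have step: "F x = F (fps_const (fps_nth x 0)) + ext_scale scale fps_X (F (fps_shift 1 x))" for x
    by (metis F.add F.scale fps_head_tail)
  case 0
  show ?case by (subst step) (simp add: ext_scale_X_nth)
  case (Suc n)
  have "fps_nth (F x) (Suc n) =
      fps_nth (F (fps_const (fps_nth x 0))) (Suc n) + fps_nth (F (fps_shift 1 x)) n"
    by (subst step) (simp add: ext_scale_X_nth)
  also have "\<dots> = (\<Sum>j\<le>Suc n. fps_nth (F (fps_const (fps_nth x j))) (Suc n - j))"
    unfolding Suc.IH[of "fps_shift 1 x"]
    by (simp add: sum.atMost_Suc_shift del: sum.atMost_Suc)
  finally show ?case .
qed

lemma ext_linear_eq_series_map: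
  assumes "module_hom (ext_scale scale) (ext_scale scale) F"
    and "\<And>a. F (fps_const a) = Abs_fps (\<lambda>i. \<tau> i a)"
  shows "F = series_map \<tau>"
proof (rule ext, rule fps_ext)
  fix x n show "fps_nth (F x) n = fps_nth (series_map \<tau> x) n"
    unfolding ext_linear_nth[OF assms(1), of x n] by (simp add: assms(2) series_map_nth)
qed

lemma ext_bilinear_nth:
  assumes "bilinear_map (ext_scale scale) b"
  shows "fps_nth (b x y) n =
    (\<Sum>j\<le>n. \<Sum>k\<le>n - j. fps_nth (b (fps_const (fps_nth x j)) (fps_const (fps_nth y k))) (n - j - k))"
proof -
  have "fps_nth (b x y) n = (\<Sum>j\<le>n. fps_nth (b (fps_const (fps_nth x j)) y) (n - j))"
    using assms by (intro ext_linear_nth) (simp add: bilinear_map_def)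
  also have "\<dots> = (\<Sum>j\<le>n. \<Sum>k\<le>n - j.
      fps_nth (b (fps_const (fps_nth x j)) (fps_const (fps_nth y k))) (n - j - k))"
    using assms by (intro sum.cong refl ext_linear_nth) (simp add: bilinear_map_def)
  finally show ?thesis .
qed

lemma ext_bilinear_eqI:
  assumes "bilinear_map (ext_scale scale) b" "bilinear_map (ext_scale scale) b'"
    and "\<And>a a'. b (fps_const a) (fps_const a') = b' (fps_const a) (fps_const a')"
  shows "b x y = b' x y"
  unfolding fps_eq_iff ext_bilinear_nth[OF assms(1), of x y] ext_bilinear_nth[OF assms(2), of x y]
  by (simp add: assms(3))

lemma series_map_linear:
  assumes "\<And>i. module_hom scale scale (\<tau> i)"
  shows "module_hom (ext_scale scale) (ext_scale scale) (series_map \<tau>)"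
proof -
  interpret ext: module "ext_scale scale" by (rule module_ext_scale) (rule module_axioms)
  have add: "\<tau> i (x + y) = \<tau> i x + \<tau> i y" for i x y
    using assms by (rule module_hom.add)
  have scl: "\<tau> i (scale k x) = scale k (\<tau> i x)" for i k x
    using assms by (rule module_hom.scale)
  have \<tau>_sum: "\<tau> i (sum f A) = (\<Sum>a\<in>A. \<tau> i (f a))" for i A and f :: "nat \<Rightarrow> 'b"
    using assms by (rule module_hom.sum)
  show ?thesis
  proof (unfold_locales)
    fix x y show "series_map \<tau> (x + y) = series_map \<tau> x + series_map \<tau> y"
      by (rule fps_ext) (simp add: series_map_nth add sum.distrib)
  next
    fix f x
    show "series_map \<tau> (ext_scale scale f x) = ext_scale scale f (series_map \<tau> x)"
    proof (rule fps_ext)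
      fix n
      have "fps_nth (series_map \<tau> (ext_scale scale f x)) n =
          (\<Sum>j\<le>n. \<Sum>i\<le>j. scale (fps_nth f i) (\<tau> (n - j) (fps_nth x (j - i))))"
        by (simp add: series_map_nth ext_scale_def \<tau>_sum scl)
      also have "\<dots> = (\<Sum>(j,i)\<in>(SIGMA j:{..n}. {..j}).
          scale (fps_nth f i) (\<tau> (n - j) (fps_nth x (j - i))))"
        by (rule sum.Sigma) auto
      also have "\<dots> = (\<Sum>(i,k)\<in>(SIGMA i:{..n}. {..n - i}).
          scale (fps_nth f i) (\<tau> (n - i - k) (fps_nth x k)))"
        by (rule sum.reindex_bij_witness
            [where i = "\<lambda>(i,k). (i + k, i)" and j = "\<lambda>(j,i). (i, j - i)"]) auto
      also have "\<dots> = (\<Sum>i\<le>n. \<Sum>k\<le>n - i. scale (fps_nth f i) (\<tau> (n - i - k) (fps_nth x k)))"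
        by (rule sum.Sigma[symmetric]) auto
      also have "\<dots> = fps_nth (ext_scale scale f (series_map \<tau> x)) n"
        by (simp add: series_map_nth ext_scale_def scale_sum_right)
      finally show "fps_nth (series_map \<tau> (ext_scale scale f x)) n =
          fps_nth (ext_scale scale f (series_map \<tau> x)) n" .
    qed
  qed
qed

lemma series_map_in_ext_sub:
  assumes "subspace A" "\<And>i a. a \<in> A \<Longrightarrow> \<tau> i a \<in> A" "x \<in> ext_sub A"
  shows "series_map \<tau> x \<in> ext_sub A"
  using assms by (auto simp: ext_sub_def series_map_nth intro!: subspace_sum)

end

lemma bilinear_map_compose:
  assumes "module_hom sc sc T" "bilinear_map sc b"
  shows "bilinear_map sc (\<lambda>x y. T (b x y))" "bilinear_map sc (\<lambda>x y. b (T x) (T y))"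
  using assms module_hom_compose[of sc sc _ sc T] module_hom_compose[of sc sc T sc]
  unfolding bilinear_map_def comp_def by blast+


section \<open>Consequences of the axioms in characteristic 2\<close>

context hom_lie_superalgebra
begin

lemma add_self: "x + x = (0::'v)"
proof -
  have "(1 + 1 :: 'r) = 0"
    using of_nat_CHAR[where ?'a = 'r] char_2 by simp
  then show ?thesis by (metis scale_left_distrib scale_one scale_zero_left)
qed

lemma uminus_eq: "- x = (x::'v)"
  using add_self[of x] by (simp add: minus_unique)

lemma diff_eq: "x - y = x + (y::'v)"
  using uminus_eq[of y] by (metis diff_conv_add_uminus)

lemma add_eq_zero_iff: "x + y = 0 \<longleftrightarrow> x = (y::'v)"
  using uminus_eq[of y] by (simp add: add_eq_0_iff2)

lemma br_add: "br (x + y) z = br x z + br y z" "br z (x + y) = br z x + br z y"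
  using br_bilinear by (auto simp: bilinear_map_def dest: module_hom.add)

lemma br_scale: "br (sc k x) z = sc k (br x z)" "br z (sc k x) = sc k (br z x)"
  using br_bilinear by (auto simp: bilinear_map_def dest: module_hom.scale)

lemma br_zero: "br 0 z = 0" "br z 0 = 0"
  using br_scale(1)[of 0] br_scale(2)[of _ 0] by simp_all

lemma \<alpha>_add: "\<alpha> (x + y) = \<alpha> x + \<alpha> y"
  using \<alpha>_linear by (rule module_hom.add)

lemma \<alpha>_zero: "\<alpha> 0 = 0"
  using \<alpha>_linear by (rule module_hom.zero)

lemma subspaces: "subspace g0" "subspace g1"
  using decomposition by (auto simp: super_decomposition_def)

lemma s_add:
  assumes "x \<in> g1" "y \<in> g1"
  shows "s (x + y) = s x + s y + br x y"
proof -
  have "s x + s y + br x y = s (x + y) + (s x + s x) + (s y + s y)"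
    unfolding s_polar[OF assms, symmetric] by (simp only: ac_simps)
  then show ?thesis by (simp add: add_self)
qed

text \<open>
  Replacing \<open>x\<close> by \<open>x + y\<close> in \<open>[s(x), \<alpha>(z)] = [\<alpha>(x), [x, z]]\<close> and cancelling the two instances
  for \<open>x\<close> and \<open>y\<close> leaves the identity that two odd elements satisfy with any third element.
\<close>

lemma s_action_polar:
  assumes "x \<in> g1" "y \<in> g1"
  shows "br (br x y) (\<alpha> z) = br (\<alpha> x) (br y z) + br (\<alpha> y) (br x z)"
proof -
  have "br (s (x + y)) (\<alpha> z) = br (\<alpha> (x + y)) (br (x + y) z)"
    using assms subspaces by (intro s_action) (simp add: subspace_add)
  then have "br (\<alpha> x) (br x z) + br (\<alpha> y) (br y z) + br (br x y) (\<alpha> z) =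
      br (\<alpha> x) (br x z) + br (\<alpha> y) (br y z) + (br (\<alpha> x) (br y z) + br (\<alpha> y) (br x z))"
    by (simp add: s_add[OF assms] s_action assms br_add \<alpha>_add ac_simps)
  then show ?thesis by (simp only: add_left_cancel)
qed

text \<open>
  The expression is additive in each argument and invariant under cyclic permutations. On homogeneous
  arguments it is an axiom if all three are even, the module axiom if exactly one is odd, and the
  polarized squaring axiom if at least two are odd; a permutation of the
  arguments brings every case into one of these forms, as the bracket is symmetric and \<open>x + x = 0\<close>.
\<close>

lemma jacobi: "br (\<alpha> x) (br y z) + br (\<alpha> y) (br z x) + br (\<alpha> z) (br x y) = 0"
proof -
  define J where "J x y z = br (\<alpha> x) (br y z) + br (\<alpha> y) (br z x) + br (\<alpha> z) (br x y)" for x y z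
  have J_add: "J (x + x') y z = J x y z + J x' y z" "J x (y + y') z = J x y z + J x y' z"
    "J x y (z + z') = J x y z + J x y z'" for x x' y y' z z'
    unfolding J_def by (simp_all add: br_add \<alpha>_add ac_simps)
  have cyc: "J x y z = J y z x" for x y z unfolding J_def by (simp add: ac_simps)
  have J_zero: "J x y z = 0"
    if "br (br x y) (\<alpha> z) = br (\<alpha> x) (br y z) + br (\<alpha> y) (br x z)" for x y z
    using that br_symmetric[of "\<alpha> z"] br_symmetric[of z x] by (simp add: J_def add_self)
  have J000: "J x y z = 0" if "x \<in> g0" "y \<in> g0" "z \<in> g0" for x y z
    using hom_jacobi[OF that] by (simp add: J_def)
  have J001: "J x y z = 0" if "x \<in> g0" "y \<in> g0" "z \<in> g1" for x y z
    using that by (intro J_zero action)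
  have J11: "J x y z = 0" if "x \<in> g1" "y \<in> g1" for x y z
    using that by (intro J_zero s_action_polar)
  have split: "\<exists>a\<in>g0. \<exists>b\<in>g1. w = a + b" for w
    using decomposition by (auto simp: super_decomposition_def)
  from split[of x] split[of y] split[of z] obtain x0 x1 y0 y1 z0 z1
    where mem: "x0 \<in> g0" "x1 \<in> g1" "y0 \<in> g0" "y1 \<in> g1" "z0 \<in> g0" "z1 \<in> g1"
      and eq: "x = x0 + x1" "y = y0 + y1" "z = z0 + z1" by blast
  have "J x0 y0 z0 = 0" "J x0 y0 z1 = 0" "J x1 y1 z0 = 0" "J x1 y1 z1 = 0"
    using mem J000 J001 J11 by auto
  moreover have "J x1 y0 z0 = 0" "J x0 y1 z1 = 0"
    using mem J001 J11 cyc[of x1 y0 z0] cyc[of x0 y1 z1] by auto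
  moreover have "J x0 y1 z0 = 0" "J x1 y0 z1 = 0"
    using mem J001 J11 cyc[of z0 x0 y1] cyc[of z1 x1 y0] by auto
  ultimately have "J x y z = 0" unfolding eq J_add by simp
  then show ?thesis by (simp add: J_def)
qed

end


section \<open>Coefficients of a deformation\<close>

locale formal_deformation =
  fixes sc :: "'k::field \<Rightarrow> 'v::ab_group_add \<Rightarrow> 'v"
    and g0 g1 :: "'v set"
    and br :: "'v \<Rightarrow> 'v \<Rightarrow> 'v"
    and s \<alpha> :: "'v \<Rightarrow> 'v"
    and c :: "nat \<Rightarrow> 'v \<Rightarrow> 'v \<Rightarrow> 'v"
    and p :: "nat \<Rightarrow> 'v \<Rightarrow> 'v"
    and brt :: "'v fps \<Rightarrow> 'v fps \<Rightarrow> 'v fps"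
    and st :: "'v fps \<Rightarrow> 'v fps"
  assumes undeformed: "hom_lie_superalgebra sc g0 g1 br s \<alpha>"
    and deformation: "deformation sc g0 g1 br s \<alpha> c p brt st"

sublocale formal_deformation \<subseteq> hom_lie_superalgebra sc g0 g1 br s \<alpha>
  by (rule undeformed)

sublocale formal_deformation \<subseteq> t: hom_lie_superalgebra
    "ext_scale sc" "ext_sub g0" "ext_sub g1" brt st "ext_map \<alpha>"
  using deformation by (simp add: deformation_def)

context formal_deformation
begin

lemma brt_const: "brt (fps_const x) (fps_const y) = Abs_fps (\<lambda>i. c i x y)"
  using deformation by (simp add: deformation_def)

lemma st_const: "x \<in> g1 \<Longrightarrow> st (fps_const x) = Abs_fps (\<lambda>i. p i x)"
  using deformation by (simp add: deformation_def)

lemma c_zero: "c 0 x y = br x y"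
  using deformation by (simp add: deformation_def)

lemma p_zero: "x \<in> g1 \<Longrightarrow> p 0 x = s x"
  using deformation by (simp add: deformation_def)

lemma c_p_cochain: "0 < i \<Longrightarrow> (c i, p i) \<in> XC2 sc g1 \<alpha>"
  using deformation by (simp add: deformation_def XC2_even_def)

lemma c_self: "0 < i \<Longrightarrow> c i x x = 0"
  using c_p_cochain[of i] by (simp add: XC2_def)

lemma c_symmetric: "c i x y = c i y x"
  using t.br_symmetric[of "fps_const x" "fps_const y"] by (simp add: brt_const fps_eq_iff)

lemma const_odd: "x \<in> g1 \<Longrightarrow> fps_const x \<in> ext_sub g1"
  using subspaces by (intro fps_const_in_ext_sub) (simp_all add: subspace_0)

lemma brt_nth: "fps_nth (brt x y) n = (\<Sum>(i,j,k) | i + j + k = n. c i (fps_nth x j) (fps_nth y k))"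
  unfolding ext_bilinear_nth[OF t.br_bilinear, of x y] sum_triples_with_total
  by (simp add: brt_const)

lemma st_head_tail:
  assumes "x \<in> ext_sub g1"
  shows "st x = st (fps_const (fps_nth x 0)) + ext_scale sc (fps_X ^ 2) (st (fps_shift 1 x)) +
    ext_scale sc fps_X (brt (fps_const (fps_nth x 0)) (fps_shift 1 x))"
proof -
  have tail: "fps_shift 1 x \<in> ext_sub g1" using assms by (rule fps_shift_in_ext_sub)
  have "st x = st (fps_const (fps_nth x 0) + ext_scale sc fps_X (fps_shift 1 x))"
    by (metis fps_head_tail)
  also have "\<dots> = st (fps_const (fps_nth x 0)) + st (ext_scale sc fps_X (fps_shift 1 x)) +
      brt (fps_const (fps_nth x 0)) (ext_scale sc fps_X (fps_shift 1 x))"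
    using assms tail subspaces
    by (intro t.s_add const_odd ext_scale_in_ext_sub) (auto simp: ext_sub_def)
  finally show ?thesis unfolding t.s_scale[OF tail] t.br_scale .
qed

text \<open>
  The squaring of a power series. Only finite additivity up to the bracket is available, so the sum
  over all coefficients is reached by peeling off the constant term and inducting on the degree.
\<close>

lemma st_nth:
  assumes "x \<in> ext_sub g1"
  shows "fps_nth (st x) n =
    (\<Sum>(i,j) | 2 * i + j = n. p j (fps_nth x i)) +
    (\<Sum>(u,v,j) | u + v + j = n \<and> u < v. c j (fps_nth x u) (fps_nth x v))"
  using assms
proof (induction n arbitrary: x rule: less_induct)
  case (less n)
  let ?y = "fps_shift 1 x"
  have y: "?y \<in> ext_sub g1" using less.prems by (rule fps_shift_in_ext_sub)
  have x0: "fps_nth x 0 \<in> g1" using less.prems by (simp add: ext_sub_def)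
  have mixed: "fps_nth (ext_scale sc fps_X (brt (fps_const (fps_nth x 0)) ?y)) n =
      (\<Sum>v\<in>{1..n}. c (n - v) (fps_nth x 0) (fps_nth x v))"
  proof (cases n)
    case (Suc m)
    have "fps_nth (brt (fps_const (fps_nth x 0)) ?y) m =
        (\<Sum>k\<le>m. c (m - k) (fps_nth x 0) (fps_nth x (Suc k)))"
      using ext_linear_nth[of "brt (fps_const (fps_nth x 0))" ?y m] t.br_bilinear
      by (simp add: bilinear_map_def brt_const)
    also have "\<dots> = (\<Sum>v\<in>{1..n}. c (n - v) (fps_nth x 0) (fps_nth x v))"
      unfolding Suc by (rule sum.reindex_bij_witness[where i = "\<lambda>v. v - 1" and j = Suc]) auto
    finally show ?thesis by (simp add: ext_scale_X_nth Suc)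
  qed (simp add: ext_scale_X_nth)
  have tail: "fps_nth (ext_scale sc (fps_X ^ 2) (st ?y)) n = (if n < 2 then 0 else
      (\<Sum>(i,j) | 2 * i + j = n - 2. p j (fps_nth x (Suc i))) +
      (\<Sum>(u,v,j) | u + v + j = n - 2 \<and> u < v. c j (fps_nth x (Suc u)) (fps_nth x (Suc v))))"
    using less.IH[OF _ y, of "n - 2"] by (simp add: ext_scale_X2_nth)
  have "fps_nth (st x) n = p n (fps_nth x 0) +
      fps_nth (ext_scale sc (fps_X ^ 2) (st ?y)) n +
      fps_nth (ext_scale sc fps_X (brt (fps_const (fps_nth x 0)) ?y)) n"
    by (subst st_head_tail[OF less.prems]) (simp add: st_const[OF x0])
  then show ?case
    unfolding mixed tail sum_doubled_pairs_rec[of _ n] sum_ordered_triples_rec[of _ n]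
    by (simp add: ac_simps)
qed

lemma brt_const_left_nth_1:
  "fps_nth (brt (fps_const a) y) 1 = br a (fps_nth y 1) + c 1 a (fps_nth y 0)"
  using ext_linear_nth[of "brt (fps_const a)" y 1] t.br_bilinear
  by (simp add: bilinear_map_def brt_const c_zero add.commute)

text \<open>
  The cocycle conditions are the coefficients of degree 1 of two identities that hold in the
  deformation, evaluated on constant series. The symmetry of \<open>c 1\<close> matches the order of
  arguments in \<^const>\<open>d2c\<close> and \<^const>\<open>d2p\<close>.
\<close>

lemma infinitesimal_cocycle: "(c 1, p 1) \<in> Z2 sc g1 br s \<alpha>"
proof -
  have \<alpha>t: "ext_map \<alpha> (fps_const a) = fps_const (\<alpha> a)" for a
    by (simp add: ext_map_fps_const \<alpha>_zero)
  have nested: "fps_nth (brt (fps_const a) (brt (fps_const x) (fps_const y))) 1 =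
      br a (c 1 x y) + c 1 (br x y) a" for a x y
    unfolding brt_const_left_nth_1 brt_const fps_nth_Abs_fps c_zero c_symmetric[of 1 a "br x y"] ..
  have "d2c br \<alpha> (c 1) z1 z2 z3 = 0" for z1 z2 z3
  proof -
    have "fps_nth (brt (ext_map \<alpha> (fps_const z1)) (brt (fps_const z2) (fps_const z3)) +
        brt (ext_map \<alpha> (fps_const z2)) (brt (fps_const z3) (fps_const z1)) +
        brt (ext_map \<alpha> (fps_const z3)) (brt (fps_const z1) (fps_const z2))) 1 = 0"
      by (simp only: t.jacobi fps_zero_nth)
    then show ?thesis unfolding \<alpha>t fps_add_nth nested d2c_def by (simp add: ac_simps)
  qed
  moreover have "d2p br s \<alpha> (c 1) (p 1) x z = 0" if x: "x \<in> g1" for x z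
  proof -
    have "fps_nth (brt (fps_const (\<alpha> z)) (st (fps_const x))) 1 =
        fps_nth (brt (fps_const (\<alpha> x)) (brt (fps_const x) (fps_const z))) 1"
      using t.s_action[OF const_odd[OF x], of "fps_const z"] by (simp add: \<alpha>t t.br_symmetric)
    moreover have "fps_nth (brt (fps_const (\<alpha> z)) (st (fps_const x))) 1 =
        br (\<alpha> z) (p 1 x) + c 1 (s x) (\<alpha> z)"
      unfolding brt_const_left_nth_1 st_const[OF x] fps_nth_Abs_fps p_zero[OF x]
        c_symmetric[of 1 "\<alpha> z" "s x"] ..
    ultimately have "br (\<alpha> z) (p 1 x) + c 1 (s x) (\<alpha> z) =
        br (\<alpha> x) (c 1 x z) + c 1 (br x z) (\<alpha> x)"
      by (simp only: nested)
    then have "br (\<alpha> z) (p 1 x) + c 1 (s x) (\<alpha> z) +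
        (br (\<alpha> x) (c 1 x z) + c 1 (br x z) (\<alpha> x)) = 0"
      by (simp only: add_eq_zero_iff)
    then show ?thesis by (simp add: d2p_def ac_simps)
  qed
  ultimately show ?thesis using c_p_cochain[of 1] by (simp add: Z2_def)
qed

end


section \<open>Two deformations and a power series of maps\<close>

locale two_deformations =
  D: formal_deformation sc g0 g1 br s \<alpha> c p brt st +
  D': formal_deformation sc g0 g1 br s \<alpha> c' p' brt' st'
  for sc :: "'k::field \<Rightarrow> 'v::ab_group_add \<Rightarrow> 'v"
    and g0 g1 br s \<alpha> c p brt st c' p' brt' st'
begin

lemma coefficient_maps_linear: "coefficient_maps sc g0 g1 \<alpha> \<tau> \<Longrightarrow> module_hom sc sc (\<tau> i)"
  by (cases "i = 0") (auto simp: coefficient_maps_def D.module_hom_id)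

lemma coefficient_maps_even: "coefficient_maps sc g0 g1 \<alpha> \<tau> \<Longrightarrow> even_map g0 g1 (\<tau> i)"
  by (cases "i = 0") (auto simp: coefficient_maps_def even_map_def)

lemma coefficient_maps_\<alpha>: "coefficient_maps sc g0 g1 \<alpha> \<tau> \<Longrightarrow> \<tau> i (\<alpha> x) = \<alpha> (\<tau> i x)"
  by (cases "i = 0") (auto simp: coefficient_maps_def)

text \<open>
  Two series agree if and only if all their coefficients do, and \<^const>\<open>linked\<close> lists these
  coefficients in positive degree. In degree 0 both sides reduce to the undeformed bracket and
  squaring. The series \<open>\<Sum>i. t^i \<tau> i x\<close> has the odd coefficients \<open>\<tau> i x\<close>, to which \<open>st_nth\<close>
  applies.
\<close>

lemma linked_iff_on_constants:
  assumes \<tau>: "coefficient_maps sc g0 g1 \<alpha> \<tau>"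
  shows "linked g1 c p c' p' \<tau> \<longleftrightarrow>
    (\<forall>x y. series_map \<tau> (brt' (fps_const x) (fps_const y)) =
       brt (series_map \<tau> (fps_const x)) (series_map \<tau> (fps_const y))) \<and>
    (\<forall>x\<in>g1. series_map \<tau> (st' (fps_const x)) = st (series_map \<tau> (fps_const x)))"
    (is "_ \<longleftrightarrow> ?br \<and> ?st")
proof -
  have \<tau>0: "\<tau> 0 = id" using \<tau> by (simp add: coefficient_maps_def)
  have "\<tau> i 0 = 0" for i
    using coefficient_maps_linear[OF \<tau>] by (rule module_hom.zero)
  note const = series_map_fps_const[of \<tau>, OF this]
  have bracket: "?br \<longleftrightarrow> (\<forall>n>0. \<forall>x y. (\<Sum>(i,j) | i + j = n. \<tau> i (c' j x y)) =
      (\<Sum>(i,j,k) | i + j + k = n. c i (\<tau> j x) (\<tau> k y)))"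
  proof -
    have lhs: "fps_nth (series_map \<tau> (brt' (fps_const x) (fps_const y))) n =
        (\<Sum>(i,j) | i + j = n. \<tau> i (c' j x y))" for n x y
      by (simp add: series_map_nth D'.brt_const sum_pairs_with_total)
    have rhs: "fps_nth (brt (series_map \<tau> (fps_const x)) (series_map \<tau> (fps_const y))) n =
        (\<Sum>(i,j,k) | i + j + k = n. c i (\<tau> j x) (\<tau> k y))" for n x y
      by (simp add: D.brt_nth const)
    have zero: "(\<Sum>(i,j) | i + j = 0. \<tau> i (c' j x y)) =
        (\<Sum>(i,j,k) | i + j + k = 0. c i (\<tau> j x) (\<tau> k y))" for x y
      unfolding sum_pairs_with_total sum_triples_with_total
      by (simp add: \<tau>0 D.c_zero D'.c_zero)
    show ?thesis
    proof (intro iffI allI impI)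
      fix n x y
      assume ?br
      then have "series_map \<tau> (brt' (fps_const x) (fps_const y)) =
          brt (series_map \<tau> (fps_const x)) (series_map \<tau> (fps_const y))" by blast
      then show "(\<Sum>(i,j) | i + j = n. \<tau> i (c' j x y)) =
          (\<Sum>(i,j,k) | i + j + k = n. c i (\<tau> j x) (\<tau> k y))"
        unfolding lhs[symmetric] rhs[symmetric] by (rule arg_cong)
    next
      fix x y
      assume pos: "\<forall>n>0. \<forall>x y. (\<Sum>(i,j) | i + j = n. \<tau> i (c' j x y)) =
          (\<Sum>(i,j,k) | i + j + k = n. c i (\<tau> j x) (\<tau> k y))"
      show "series_map \<tau> (brt' (fps_const x) (fps_const y)) =
          brt (series_map \<tau> (fps_const x)) (series_map \<tau> (fps_const y))"
      proof (rule fps_ext, unfold lhs rhs)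
        fix n
        show "(\<Sum>(i,j) | i + j = n. \<tau> i (c' j x y)) =
            (\<Sum>(i,j,k) | i + j + k = n. c i (\<tau> j x) (\<tau> k y))"
          using pos[rule_format, of n x y] zero[of x y] by (cases "n = 0") simp_all
      qed
    qed
  qed
  have squaring: "?st \<longleftrightarrow> (\<forall>n>0. \<forall>x\<in>g1. (\<Sum>(i,j) | i + j = n. \<tau> i (p' j x)) =
      (\<Sum>(i,j) | i + j = n. c i x (\<tau> j x)) +
      (\<Sum>(i,j) | 2 * i + j = n. p j (\<tau> i x)) +
      (\<Sum>(u,v,j) | u + v + j = n \<and> 1 \<le> u \<and> u < v. c j (\<tau> u x) (\<tau> v x)))"
  proof -
    have lhs: "fps_nth (series_map \<tau> (st' (fps_const x))) n =
        (\<Sum>(i,j) | i + j = n. \<tau> i (p' j x))" if "x \<in> g1" for n x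
      using that by (simp add: series_map_nth D'.st_const sum_pairs_with_total)
    have odd: "series_map \<tau> (fps_const x) \<in> ext_sub g1" if "x \<in> g1" for x
      using coefficient_maps_even[OF \<tau>] D.subspaces that
      by (intro D.series_map_in_ext_sub D.const_odd) (auto simp: even_map_def image_subset_iff)
    have "fps_nth (st (series_map \<tau> (fps_const x))) n =
        (\<Sum>(i,j) | i + j = n. c i x (\<tau> j x)) +
        (\<Sum>(i,j) | 2 * i + j = n. p j (\<tau> i x)) +
        (\<Sum>(u,v,j) | u + v + j = n \<and> 1 \<le> u \<and> u < v. c j (\<tau> u x) (\<tau> v x))"
      if "x \<in> g1" "n > 0" for n x
    proof -
      \<comment> \<open>The brackets with \<open>u = 0\<close> are the first sum of the formula without its term \<open>c n x x\<close>,
        which vanishes because \<open>n > 0\<close>.\<close>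
      have "{..n} = insert 0 {1..n}" by auto
      then have "(\<Sum>(i,j) | i + j = n. c i x (\<tau> j x)) = (\<Sum>v\<in>{1..n}. c (n - v) x (\<tau> v x))"
        using \<open>n > 0\<close> by (simp add: sum_pairs_with_total \<tau>0 D.c_self)
      then show ?thesis
        unfolding D.st_nth[OF odd[OF that(1)]] sum_ordered_triples_first_zero
        by (simp add: const \<tau>0 ac_simps)
    qed
    note rhs = this
    have zero: "fps_nth (series_map \<tau> (st' (fps_const x))) 0 =
        fps_nth (st (series_map \<tau> (fps_const x))) 0" if "x \<in> g1" for x
      unfolding D.st_nth[OF odd[OF that]] lhs[OF that] sum_pairs_with_total
        sum_doubled_pairs_rec[of _ 0] sum_ordered_triples_rec[of _ 0]
      by (simp add: that \<tau>0 D'.p_zero D.p_zero const)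
    show ?thesis
    proof (intro iffI allI impI ballI)
      fix n :: nat and x
      assume ?st "n > 0" "x \<in> g1"
      then have "fps_nth (series_map \<tau> (st' (fps_const x))) n =
          fps_nth (st (series_map \<tau> (fps_const x))) n" by simp
      then show "(\<Sum>(i,j) | i + j = n. \<tau> i (p' j x)) =
          (\<Sum>(i,j) | i + j = n. c i x (\<tau> j x)) +
          (\<Sum>(i,j) | 2 * i + j = n. p j (\<tau> i x)) +
          (\<Sum>(u,v,j) | u + v + j = n \<and> 1 \<le> u \<and> u < v. c j (\<tau> u x) (\<tau> v x))"
        unfolding lhs[OF \<open>x \<in> g1\<close>] rhs[OF \<open>x \<in> g1\<close> \<open>n > 0\<close>] .
    next
      fix x
      assume pos: "\<forall>n>0. \<forall>x\<in>g1. (\<Sum>(i,j) | i + j = n. \<tau> i (p' j x)) =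
          (\<Sum>(i,j) | i + j = n. c i x (\<tau> j x)) +
          (\<Sum>(i,j) | 2 * i + j = n. p j (\<tau> i x)) +
          (\<Sum>(u,v,j) | u + v + j = n \<and> 1 \<le> u \<and> u < v. c j (\<tau> u x) (\<tau> v x))"
        and x: "x \<in> g1"
      show "series_map \<tau> (st' (fps_const x)) = st (series_map \<tau> (fps_const x))"
      proof (rule fps_ext)
        fix n
        show "fps_nth (series_map \<tau> (st' (fps_const x))) n =
            fps_nth (st (series_map \<tau> (fps_const x))) n"
        proof (cases "n = 0")
          case True
          then show ?thesis using zero[OF x] by simp
        next
          case False
          then show ?thesis
            using pos x lhs[OF x, of n] rhs[OF x, of n] by simp
        qed
      qed
    qed
  qed
  show ?thesis unfolding bracket squaring linked_def by blast
qed

text \<open>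
  By \<open>K[[t]]\<close>-linearity an isomorphism with the given values on constant series is
  \<^term>\<open>series_map \<tau>\<close>, so only the compatibility with brackets and squarings is in question. For
  brackets the passage from constants to all series is bilinearity. For squarings, with
  \<open>x = a + t y\<close>, both \<open>T (s' x)\<close> and \<open>s (T x)\<close> split into a term in \<open>a\<close>, the same mixed bracket,
  and \<open>t^2\<close> times the corresponding expression for \<open>y\<close>, so they agree in degree \<open>n\<close> as soon as
  those for \<open>y\<close> agree in degree \<open>n - 2\<close>.
\<close>

lemma iso_through_iff_linked:
  assumes \<tau>: "coefficient_maps sc g0 g1 \<alpha> \<tau>"
  shows "iso_through sc g0 g1 \<alpha> brt' st' brt st \<tau> \<longleftrightarrow> linked g1 c p c' p' \<tau>"
proof -
  have "\<tau> i 0 = 0" for i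
    using coefficient_maps_linear[OF \<tau>] by (rule module_hom.zero)
  note const = series_map_fps_const[of \<tau>, OF this]
  show ?thesis
  proof
    assume "iso_through sc g0 g1 \<alpha> brt' st' brt st \<tau>"
    then obtain T where T: "T (fps_const a) = Abs_fps (\<lambda>i. \<tau> i a)"
      and iso: "hom_lie_superalgebra_iso (ext_scale sc) (ext_sub g0) (ext_sub g1) brt' st' (ext_map \<alpha>)
        (ext_scale sc) (ext_sub g0) (ext_sub g1) brt st (ext_map \<alpha>) T" for a
      unfolding iso_through_def by blast
    have "T = series_map \<tau>"
      using iso T by (intro D.ext_linear_eq_series_map) (auto simp: hom_lie_superalgebra_iso_def)
    with iso show "linked g1 c p c' p' \<tau>"
      unfolding linked_iff_on_constants[OF \<tau>] hom_lie_superalgebra_iso_def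
      by (auto simp: D.const_odd)
  next
    let ?T = "series_map \<tau>"
    assume "linked g1 c p c' p' \<tau>"
    then have br_const: "?T (brt' (fps_const x) (fps_const y)) =
        brt (?T (fps_const x)) (?T (fps_const y))"
      and st_const: "x \<in> g1 \<Longrightarrow> ?T (st' (fps_const x)) = st (?T (fps_const x))" for x y
      unfolding linked_iff_on_constants[OF \<tau>] by auto
    have lin: "module_hom (ext_scale sc) (ext_scale sc) ?T"
      using coefficient_maps_linear[OF \<tau>] by (rule D.series_map_linear)
    interpret T: module_hom "ext_scale sc" "ext_scale sc" ?T by (rule lin)
    have bracket: "?T (brt' x y) = brt (?T x) (?T y)" for x y
      by (rule D.ext_bilinear_eqI[OF bilinear_map_compose(1)[OF lin D'.t.br_bilinear]
          bilinear_map_compose(2)[OF lin D.t.br_bilinear] br_const])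
    have even: "x \<in> ext_sub g0 \<Longrightarrow> ?T x \<in> ext_sub g0" "x \<in> ext_sub g1 \<Longrightarrow> ?T x \<in> ext_sub g1" for x
      using coefficient_maps_even[OF \<tau>] D.subspaces
      by (auto intro!: D.series_map_in_ext_sub simp: even_map_def image_subset_iff)
    have "fps_nth (?T (st' x)) n = fps_nth (st (?T x)) n" if "x \<in> ext_sub g1" for x n
      using that
    proof (induction n arbitrary: x rule: less_induct)
      case (less n)
      let ?a = "fps_const (fps_nth x 0)" and ?y = "fps_shift 1 x"
      have x0: "fps_nth x 0 \<in> g1" using less.prems by (simp add: ext_sub_def)
      have y: "?y \<in> ext_sub g1" using less.prems by (rule fps_shift_in_ext_sub)
      have "st (?T x) = st (?T ?a + ext_scale sc fps_X (?T ?y))"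
        by (metis D.fps_head_tail T.add T.scale)
      also have "\<dots> = st (?T ?a) + ext_scale sc (fps_X ^ 2) (st (?T ?y)) +
          ext_scale sc fps_X (brt (?T ?a) (?T ?y))"
        using x0 y D.subspaces
        by (subst D.t.s_add)
          (simp_all add: D.t.s_scale D.t.br_scale even D.const_odd D.ext_scale_in_ext_sub)
      finally have right: "st (?T x) = st (?T ?a) + ext_scale sc (fps_X ^ 2) (st (?T ?y)) +
          ext_scale sc fps_X (brt (?T ?a) (?T ?y))" .
      have left: "?T (st' x) = st (?T ?a) + ext_scale sc (fps_X ^ 2) (?T (st' ?y)) +
          ext_scale sc fps_X (brt (?T ?a) (?T ?y))"
        by (subst D'.st_head_tail[OF less.prems])
          (simp add: T.add T.scale bracket st_const[OF x0])
      show ?case unfolding left right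
        using less.IH[OF _ y, of "n - 2"] by (simp add: D.ext_scale_X2_nth)
    qed
    then have squaring: "?T (st' x) = st (?T x)" if "x \<in> ext_sub g1" for x
      using that by (intro fps_ext)
    have twist: "?T (ext_map \<alpha> x) = ext_map \<alpha> (?T x)" for x
      by (rule fps_ext) (simp add: series_map_nth ext_map_def coefficient_maps_\<alpha>[OF \<tau>]
          module_hom.sum[OF D.\<alpha>_linear])
    have "bij ?T" using \<tau> by (intro series_map_bij) (simp add: coefficient_maps_def)
    with lin bracket even squaring twist const
    show "iso_through sc g0 g1 \<alpha> brt' st' brt st \<tau>"
      unfolding iso_through_def hom_lie_superalgebra_iso_def by blast
  qed
qed

text \<open>
  The coefficient maps of the inverse \<open>S\<close> of \<open>T\<close> are read off from its values on constant series.
  They are even because \<open>S\<close> is: if \<open>T\<close> sends \<open>a + b\<close>, with \<open>a\<close> even and \<open>b\<close> odd, to an even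
  element, then \<open>T b\<close> is both even and odd, hence zero, and \<open>b = 0\<close> by injectivity. The identity
  in degree 0 comes from comparing the constant terms of \<open>T (S a) = a\<close>.
\<close>

lemma iso_through_inverse:
  assumes \<tau>: "coefficient_maps sc g0 g1 \<alpha> \<tau>"
    and "iso_through sc g0 g1 \<alpha> brt st brt' st' \<tau>"
  shows "\<exists>\<sigma>. coefficient_maps sc g0 g1 \<alpha> \<sigma> \<and> iso_through sc g0 g1 \<alpha> brt' st' brt st \<sigma>"
proof -
  obtain T where T: "\<And>a. T (fps_const a) = Abs_fps (\<lambda>i. \<tau> i a)"
    and iso: "hom_lie_superalgebra_iso (ext_scale sc) (ext_sub g0) (ext_sub g1) brt st (ext_map \<alpha>)
      (ext_scale sc) (ext_sub g0) (ext_sub g1) brt' st' (ext_map \<alpha>) T"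
    using assms(2) unfolding iso_through_def by blast
  interpret T: module_hom "ext_scale sc" "ext_scale sc" T
    using iso by (simp add: hom_lie_superalgebra_iso_def)
  have bij: "bij T" and bracket: "T (brt x y) = brt' (T x) (T y)"
    and squaring: "x \<in> ext_sub g1 \<Longrightarrow> T (st x) = st' (T x)"
    and twist: "T (ext_map \<alpha> x) = ext_map \<alpha> (T x)"
    and T_even: "x \<in> ext_sub g0 \<Longrightarrow> T x \<in> ext_sub g0" "x \<in> ext_sub g1 \<Longrightarrow> T x \<in> ext_sub g1" for x y
    using iso by (auto simp: hom_lie_superalgebra_iso_def)
  define S where "S = inv T"
  have TS: "T (S x) = x" and ST: "S (T x) = x" for x
    using bij by (auto simp: S_def bij_def surj_f_inv_f)
  have S_eqI: "S y = x" if "T x = y" for x y using that ST by blast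
  have lin: "module_hom (ext_scale sc) (ext_scale sc) S"
    by unfold_locales (auto intro!: S_eqI simp: T.add T.scale TS)
  have S_br: "S (brt' x y) = brt (S x) (S y)" for x y
    by (intro S_eqI) (simp add: bracket TS)
  have S_twist: "S (ext_map \<alpha> x) = ext_map \<alpha> (S x)" for x
    by (intro S_eqI) (simp add: twist TS)
  have S_even: "(y \<in> ext_sub g0 \<longrightarrow> S y \<in> ext_sub g0) \<and> (y \<in> ext_sub g1 \<longrightarrow> S y \<in> ext_sub g1)" for y
  proof -
    have dec: "super_decomposition (ext_scale sc) (ext_sub g0) (ext_sub g1)"
      by (rule D.t.decomposition)
    then obtain a b where ab: "a \<in> ext_sub g0" "b \<in> ext_sub g1" "S y = a + b"
      unfolding super_decomposition_def by blast
    have y: "y = T a + T b" using TS[of y] by (simp add: ab(3) T.add)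
    have int: "z = 0" if "z \<in> ext_sub g0" "z \<in> ext_sub g1" for z
      using dec that unfolding super_decomposition_def by blast
    have zero: "T x = 0 \<Longrightarrow> x = 0" for x using ST[of x] S_eqI[of 0 0] by simp
    have "b = 0" if "y \<in> ext_sub g0"
    proof -
      have "T b = y - T a" using y by simp
      then have "T b \<in> ext_sub g0"
        using that T_even(1)[OF ab(1)] D.t.subspaces(1) D.t.subspace_diff by metis
      then show ?thesis using int T_even(2)[OF ab(2)] zero by blast
    qed
    moreover have "a = 0" if "y \<in> ext_sub g1"
    proof -
      have "T a = y - T b" using y by simp
      then have "T a \<in> ext_sub g1"
        using that T_even(2)[OF ab(2)] D.t.subspaces(2) D.t.subspace_diff by metis
      then show ?thesis using int T_even(1)[OF ab(1)] zero by blast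
    qed
    ultimately show ?thesis using ab by auto
  qed
  define \<sigma> where "\<sigma> i a = fps_nth (S (fps_const a)) i" for i a
  have "\<sigma> 0 a = a" for a
  proof -
    have "T = series_map \<tau>" using T T.module_hom_axioms by (intro D.ext_linear_eq_series_map)
    then have "fps_nth (T (S (fps_const a))) 0 = \<sigma> 0 a"
      using \<tau> by (simp add: series_map_nth coefficient_maps_def \<sigma>_def)
    then show ?thesis by (simp add: TS)
  qed
  moreover have "module_hom sc sc (\<sigma> i)" for i
  proof unfold_locales
    fix a b show "\<sigma> i (a + b) = \<sigma> i a + \<sigma> i b"
      unfolding \<sigma>_def fps_const_add[symmetric] by (simp only: module_hom.add[OF lin] fps_add_nth)
  next
    fix k a
    have "S (fps_const (sc k a)) = ext_scale sc (fps_const k) (S (fps_const a))"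
      unfolding D.fps_const_scale by (rule module_hom.scale[OF lin])
    moreover have "fps_nth (ext_scale sc (fps_const k) x) i = sc k (fps_nth x i)" for x
    proof -
      have "(\<Sum>j\<le>i. sc (fps_nth (fps_const k) j) (fps_nth x (i - j))) =
          (\<Sum>j\<le>i. if j = 0 then sc k (fps_nth x i) else 0)"
        by (rule sum.cong) auto
      then show ?thesis by (simp add: ext_scale_def)
    qed
    ultimately show "\<sigma> i (sc k a) = sc k (\<sigma> i a)" by (simp add: \<sigma>_def)
  qed
  moreover have "even_map g0 g1 (\<sigma> i)" for i
  proof -
    have "\<sigma> i a \<in> g0" if "a \<in> g0" for a
      using S_even[of "fps_const a"] fps_const_in_ext_sub[OF _ that] D.subspace_0[OF D.subspaces(1)]
      by (auto simp: \<sigma>_def ext_sub_def)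
    moreover have "\<sigma> i a \<in> g1" if "a \<in> g1" for a
      using S_even[of "fps_const a"] D.const_odd[OF that] by (auto simp: \<sigma>_def ext_sub_def)
    ultimately show ?thesis by (auto simp: even_map_def)
  qed
  moreover have "\<sigma> i (\<alpha> a) = \<alpha> (\<sigma> i a)" for i a
    using S_twist[of "fps_const a"]
    by (simp add: ext_map_fps_const D.\<alpha>_zero) (simp add: \<sigma>_def ext_map_def)
  ultimately have "coefficient_maps sc g0 g1 \<alpha> \<sigma>"
    by (auto simp: coefficient_maps_def)
  moreover have "iso_through sc g0 g1 \<alpha> brt' st' brt st \<sigma>"
    unfolding iso_through_def
  proof (intro exI[of _ S] conjI allI)
    show "S (fps_const a) = Abs_fps (\<lambda>i. \<sigma> i a)" for a by (rule fps_ext) (simp add: \<sigma>_def)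
    have "S (st' x) = st (S x)" if "x \<in> ext_sub g1" for x
      using that S_even by (intro S_eqI) (simp add: squaring TS)
    moreover have "bij S" unfolding S_def using bij by (rule bij_imp_bij_inv)
    ultimately show "hom_lie_superalgebra_iso
        (ext_scale sc) (ext_sub g0) (ext_sub g1) brt' st' (ext_map \<alpha>)
        (ext_scale sc) (ext_sub g0) (ext_sub g1) brt st (ext_map \<alpha>) S"
      using lin S_br S_twist S_even unfolding hom_lie_superalgebra_iso_def by blast
  qed
  ultimately show ?thesis by blast
qed

lemma linked_degree_1:
  assumes \<tau>: "coefficient_maps sc g0 g1 \<alpha> \<tau>" and "linked g1 c p c' p' \<tau>"
  shows "c' 1 x y = c 1 x y + \<tau> 1 (br x y) + br x (\<tau> 1 y) + br y (\<tau> 1 x)"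
    and "x \<in> g1 \<Longrightarrow> p' 1 x = p 1 x + \<tau> 1 (s x) + br x (\<tau> 1 x)"
proof -
  have \<tau>0: "\<tau> 0 = id" using \<tau> by (simp add: coefficient_maps_def)
  \<comment> \<open>In characteristic 2 a summand changes sides without a sign.\<close>
  have cancel: "a = d + b" if "a + b = d" for a b d :: 'v
    using that D.add_self[of b] by (metis add.assoc add.right_neutral)
  note degree_1 = assms(2)[unfolded linked_def, THEN spec, of 1, THEN mp, OF zero_less_one]
  have "(\<Sum>(i,j) | i + j = 1. \<tau> i (c' j x y)) =
      (\<Sum>(i,j,k) | i + j + k = 1. c i (\<tau> j x) (\<tau> k y))"
    by (rule degree_1[THEN conjunct1, THEN spec, THEN spec])
  then have "c' 1 x y + \<tau> 1 (br x y) = c 1 x y + br x (\<tau> 1 y) + br y (\<tau> 1 x)"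
    unfolding sum_pairs_with_total sum_triples_with_total
    by (simp add: \<tau>0 D.c_zero D'.c_zero D.br_symmetric[of y] ac_simps)
  then show "c' 1 x y = c 1 x y + \<tau> 1 (br x y) + br x (\<tau> 1 y) + br y (\<tau> 1 x)"
    using cancel[of "c' 1 x y" "\<tau> 1 (br x y)"] by (simp only: ac_simps)
  assume x: "x \<in> g1"
  have empty: "{(u,v,j). u + v + j = (1::nat) \<and> 1 \<le> u \<and> u < v} = {}" by auto
  have "(\<Sum>(i,j) | i + j = 1. \<tau> i (p' j x)) =
      (\<Sum>(i,j) | i + j = 1. c i x (\<tau> j x)) +
      (\<Sum>(i,j) | 2 * i + j = 1. p j (\<tau> i x)) +
      (\<Sum>(u,v,j) | u + v + j = 1 \<and> 1 \<le> u \<and> u < v. c j (\<tau> u x) (\<tau> v x))"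
    by (rule degree_1[THEN conjunct2, THEN bspec, OF x])
  then have "p' 1 x + \<tau> 1 (s x) = p 1 x + br x (\<tau> 1 x)"
    unfolding sum_pairs_with_total sum_doubled_pairs_rec[of _ 1] empty
    by (simp add: \<tau>0 x D.c_zero D'.p_zero D.c_self ac_simps)
  then show "p' 1 x = p 1 x + \<tau> 1 (s x) + br x (\<tau> 1 x)"
    using cancel[of "p' 1 x" "\<tau> 1 (s x)"] by (simp only: ac_simps)
qed

text \<open>
  The common class is that of \<open>(c 1, p 1)\<close>; the difference to \<open>(c' 1, p' 1)\<close> is the coboundary of
  the cochain \<open>\<tau> 1\<close>, by the formulae in degree 1.
\<close>

lemma linked_cohomologous:
  assumes \<tau>: "coefficient_maps sc g0 g1 \<alpha> \<tau>" and "linked g1 c p c' p' \<tau>"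
  shows "\<exists>X\<in>H2 sc g1 br s \<alpha>. (c' 1, p' 1) \<in> X \<and> (c 1, p 1) \<in> X"
proof -
  let ?R = "cohomologous sc g1 br s \<alpha>"
  have Z: "(c 1, p 1) \<in> Z2 sc g1 br s \<alpha>" "(c' 1, p' 1) \<in> Z2 sc g1 br s \<alpha>"
    by (rule D.infinitesimal_cocycle D'.infinitesimal_cocycle)+
  have "module_hom sc sc (\<lambda>_. 0)" by unfold_locales auto
  then have "(\<lambda>_. 0) \<in> XC1 sc \<alpha>" by (simp add: XC1_def D.\<alpha>_zero)
  then have "((c 1, p 1), (c 1, p 1)) \<in> ?R"
    using Z by (force simp: cohomologous_def B2_def d1_def D.br_zero)
  moreover have "\<tau> 1 \<in> XC1 sc \<alpha>"
    using coefficient_maps_linear[OF \<tau>] coefficient_maps_\<alpha>[OF \<tau>] by (simp add: XC1_def)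
  then have "((c 1, p 1), (c' 1, p' 1)) \<in> ?R"
    using Z linked_degree_1[OF assms]
    by (auto simp: cohomologous_def B2_def d1_def D.diff_eq D.add_self
        add.assoc[symmetric] intro!: bexI[of _ "\<tau> 1"])
  moreover have "?R `` {(c 1, p 1)} \<in> H2 sc g1 br s \<alpha>"
    unfolding H2_def using Z(1) by (rule quotientI)
  ultimately show ?thesis by blast
qed

end

theorem theorem6p10:
  fixes sc :: "'k::field \<Rightarrow> 'v::ab_group_add \<Rightarrow> 'v"
    and B g0 g1 :: "'v set"
    and br :: "'v \<Rightarrow> 'v \<Rightarrow> 'v"
    and s \<alpha> :: "'v \<Rightarrow> 'v"
    and c c' :: "nat \<Rightarrow> 'v \<Rightarrow> 'v \<Rightarrow> 'v"
    and p p' :: "nat \<Rightarrow> 'v \<Rightarrow> 'v"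
    and brt brt' :: "'v fps \<Rightarrow> 'v fps \<Rightarrow> 'v fps"
    and st st' :: "'v fps \<Rightarrow> 'v fps"
  assumes "finite_dimensional_vector_space sc B"
    and "hom_lie_superalgebra sc g0 g1 br s \<alpha>"
    and "deformation sc g0 g1 br s \<alpha> c p brt st"
    and "deformation sc g0 g1 br s \<alpha> c' p' brt' st'"
  shows
    "(\<forall>\<tau>. coefficient_maps sc g0 g1 \<alpha> \<tau> \<longrightarrow>
        (iso_through sc g0 g1 \<alpha> brt' st' brt st \<tau> \<longleftrightarrow> linked g1 c p c' p' \<tau>)) \<and>
     (equivalent_deformations sc g0 g1 \<alpha> brt st brt' st' \<longleftrightarrow>
        (\<exists>\<tau>. coefficient_maps sc g0 g1 \<alpha> \<tau> \<and> linked g1 c p c' p' \<tau>)) \<and>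
     (\<forall>\<tau>. coefficient_maps sc g0 g1 \<alpha> \<tau> \<and> linked g1 c p c' p' \<tau> \<longrightarrow>
        (\<forall>x y. c' 1 x y = c 1 x y + \<tau> 1 (br x y) + br x (\<tau> 1 y) + br y (\<tau> 1 x)) \<and>
        (\<forall>x\<in>g1. p' 1 x = p 1 x + \<tau> 1 (s x) + br x (\<tau> 1 x)) \<and>
        (\<exists>X\<in>H2 sc g1 br s \<alpha>. (c' 1, p' 1) \<in> X \<and> (c 1, p 1) \<in> X))"
proof -
  interpret A: two_deformations sc g0 g1 br s \<alpha> c p brt st c' p' brt' st'
    by (intro two_deformations.intro formal_deformation.intro assms)
  interpret A': two_deformations sc g0 g1 br s \<alpha> c' p' brt' st' c p brt st
    by (intro two_deformations.intro formal_deformation.intro assms)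
  have equivalent: "equivalent_deformations sc g0 g1 \<alpha> brt st brt' st' \<longleftrightarrow>
      (\<exists>\<tau>. coefficient_maps sc g0 g1 \<alpha> \<tau> \<and> iso_through sc g0 g1 \<alpha> brt' st' brt st \<tau>)"
    unfolding equivalent_deformations_def
    using A.iso_through_inverse A'.iso_through_inverse by blast
  show ?thesis
  proof (intro conjI allI impI ballI)
    show "equivalent_deformations sc g0 g1 \<alpha> brt st brt' st' \<longleftrightarrow>
        (\<exists>\<tau>. coefficient_maps sc g0 g1 \<alpha> \<tau> \<and> linked g1 c p c' p' \<tau>)"
      unfolding equivalent using A.iso_through_iff_linked by (simp cong: conj_cong)
  qed ((elim conjE)?,
      (rule A.iso_through_iff_linked A.linked_degree_1 A.linked_cohomologous; assumption))+
qed

end
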